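(* Let $k$ be a nonnegative locally integrable function on $(0,\infty)$ whose Laplace transform $\tilde k(p)=\int_0^\infty e^{-pt}k(t)\,dt$ exists for all $p>0$, and assume that $\tilde k$ is a Stieltjes function satisfying $\tilde k(p)\to\infty$ as $p\to 0$, $\tilde k(p)\to 0$ as $p\to\infty$, $p\tilde k(p)\to 0$ as $p\to 0$, and $p\tilde k(p)\to\infty$ as $p\to\infty$. Let $\varkappa$ be the function on $(0,\infty)$ (defined in the context) whose Laplace transform is $1/(p\tilde k(p))$. Define $$(\mathbb D_{(k)}u)(t)=\frac{d}{dt}\int_0^t k(t-\tau)u(\tau)\,d\tau-k(t)u(0),\qquad (\mathbb I_{(k)}f)(t)=\int_0^t\varkappa(t-s)f(s)\,ds .$$ Then: (i) If $f$ is a locally bounded measurable function on $(0,\infty)$, then $\mathbb D_{(k)}\mathbb I_{(k)}f=f$. (ii) If a function $u$ is absolutely continuous on $[0,\infty)$, then $(\mathbb I_{(k)}\mathbb D_{(k)}u)(t)=u(t)-u(0)$.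
   Context: A Stieltjes function is a function $\varphi$ on $(0,\infty)$ of the form $\varphi(\lambda)=\frac{a}{\lambda}+b+\int_0^\infty\frac{1}{\lambda+t}\,\sigma(dt)$ with $a,b\ge 0$ and $\sigma$ a Borel measure on $[0,\infty)$ with $\int_0^\infty(1+t)^{-1}\sigma(dt)<\infty$. Under the stated assumptions on $k$, the function $p\mapsto 1/(p\tilde k(p))$ is a Stieltjes function which can be written as $\int_0^\infty e^{-ps}\varkappa(s)\,ds$ for a completely monotone function $\varkappa$ on $(0,\infty)$; this $\varkappa$ is the kernel used in $\mathbb I_{(k)}$. The operator $\mathbb D_{(k)}$ is applied to continuous functions $u$ for which $k*u$ is almost everywhere differentiable, and $\mathbb I_{(k)}$ is defined on locally integrable functions. *)

theory Defs
  imports "HOL-Analysis.Analysis"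
begin

definition laplace :: "(real \<Rightarrow> real) \<Rightarrow> real \<Rightarrow> real" where
  "laplace g p = (LINT t:{0<..}|lebesgue. exp (- p * t) * g t)"

definition stieltjes_function :: "(real \<Rightarrow> real) \<Rightarrow> bool" where
  "stieltjes_function \<phi> \<longleftrightarrow>
     (\<exists>a b (\<sigma> :: real measure). a \<ge> 0 \<and> b \<ge> 0 \<and>
        sets \<sigma> = sets borel \<and> emeasure \<sigma> {..<0} = 0 \<and>
        (\<integral>\<^sup>+ t. ennreal (indicator {0..} t * (1 / (1 + t))) \<partial>\<sigma>) < \<infinity> \<and>
        (\<forall>x>0. \<phi> x = a / x + b + (LINT t:{0..}|\<sigma>. 1 / (x + t))))"

definition completely_monotone :: "(real \<Rightarrow> real) \<Rightarrow> bool" where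
  "completely_monotone g \<longleftrightarrow>
     (\<forall>n t. t > 0 \<longrightarrow> ((deriv ^^ n) g) differentiable (at t) \<and>
                     (-1) ^ n * (deriv ^^ n) g t \<ge> 0)"

definition conv0 :: "(real \<Rightarrow> real) \<Rightarrow> (real \<Rightarrow> real) \<Rightarrow> real \<Rightarrow> real" where
  "conv0 k u t = (LINT \<tau>:{0..t}|lebesgue. k (t - \<tau>) * u \<tau>)"

definition Dk :: "(real \<Rightarrow> real) \<Rightarrow> (real \<Rightarrow> real) \<Rightarrow> real \<Rightarrow> real" where
  "Dk k u t = deriv (conv0 k u) t - k t * u 0"

definition Ik :: "(real \<Rightarrow> real) \<Rightarrow> (real \<Rightarrow> real) \<Rightarrow> real \<Rightarrow> real" where
  "Ik \<kappa> f t = (LINT s:{0..t}|lebesgue. \<kappa> (t - s) * f s)"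

definition abs_cont_on :: "real \<Rightarrow> real \<Rightarrow> (real \<Rightarrow> real) \<Rightarrow> bool" where
  "abs_cont_on a b u \<longleftrightarrow>
     (\<forall>\<epsilon>>0. \<exists>\<delta>>0. \<forall>(n::nat) (x::nat \<Rightarrow> real) (y::nat \<Rightarrow> real).
        (\<forall>i<n. a \<le> x i \<and> x i \<le> y i \<and> y i \<le> b) \<and>
        (\<forall>i<n. \<forall>j<n. i \<noteq> j \<longrightarrow> y i \<le> x j \<or> y j \<le> x i) \<and>
        (\<Sum>i<n. y i - x i) < \<delta> \<longrightarrow>
        (\<Sum>i<n. \<bar>u (y i) - u (x i)\<bar>) < \<epsilon>)"

end

theory Submission
  imports Defs
begin

text \<open>
  Since the Laplace transforms of \<open>k\<close> and \<open>\<kappa>\<close> multiply to \<open>1 / p\<close>, uniqueness of the Laplace transform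
  gives \<open>k * \<kappa> = 1\<close> almost everywhere on the positive half-line. Tonelli's theorem then yields
  \<open>k * (\<kappa> * f) = 1 * f\<close> at every point, and (i) is Lebesgue's differentiation theorem.
  For (ii), write \<open>u = u 0 + 1 * g\<close> with \<open>g\<close> integrable; then \<open>k * u = 1 * (u 0 k + k * g)\<close>, so
  \<open>D u = k * g\<close> almost everywhere, and \<open>\<kappa> * (k * g) = 1 * g = u - u 0\<close>.
\<close>

text \<open>The relation between the kernels is known only almost everywhere, whereas
  differentiability at \<open>t\<close> involves the convolution at all points near
  \<open>t\<close>. Exchanging the integrals bridges the gap: for fixed \<open>t\<close>, the
  exceptional arguments of the inner convolution form a null set in the remaining variable, so
  equality holds at every \<open>t\<close> without any continuity of that convolution. In (ii) a
  null set is absorbed on the outside: \<open>Dk k u\<close> is identified only almost everywhere,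
  \<open>deriv\<close> is unspecified at the other points, and the integral in \<open>Ik\<close>
  does not see them, so the formula again holds at every \<open>t > 0\<close>. The density
  \<open>g\<close> has to be extracted from the epsilon-delta definition of absolute continuity. The
  route is a Jordan decomposition: the positive variations of \<open>u\<close> and
  \<open>- u\<close> are limits over dyadic grids, they are nondecreasing and inherit absolute
  continuity, their Stieltjes measures therefore have Radon-Nikodym densities, and \<open>g\<close>
  is the difference of these.\<close>

section \<open>Lebesgue differentiation\<close>

text \<open>
  The difference quotients at a bad point \<open>x\<close> violate the estimate of Henstock's lemma on the intervals
  between \<open>x\<close> and \<open>y\<close>; Vitali's theorem selects disjoint such intervals covering almost all bad points.
\<close>

lemma negligible_bad_difference_quotients:
  fixes f :: "real \<Rightarrow> real"
  assumes f: "f integrable_on {a..b}" and "0 < \<alpha>"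
  shows "negligible {x \<in> {a<..<b}. \<forall>\<delta>>0. \<exists>y\<in>{a..b}. 0 < \<bar>y - x\<bar> \<and> \<bar>y - x\<bar> < \<delta> \<and>
           \<alpha> * \<bar>y - x\<bar> < \<bar>integral {a..y} f - integral {a..x} f - (y - x) * f x\<bar>}"
    (is "negligible ?S")
  unfolding negligible_outer_le
proof (intro allI impI)
  fix e :: real assume "0 < e"
  with \<open>0 < \<alpha>\<close> have pos: "0 < e / 2 * \<alpha>" by simp
  have "f integrable_on cbox a b" using f by simp
  \<comment> \<open>A selected bad pair contributes at least \<open>\<alpha> * r\<close> to the
    Henstock sum, so the radii add up to at most \<open>e / 2\<close>; a ball of radius
    \<open>r\<close> has length \<open>2 * r\<close>, which brings the total to
    \<open>e\<close>.\<close>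
  from Henstock_lemma[OF this pos] obtain \<gamma> where \<gamma>: "gauge \<gamma>" and hen: "\<And>p. \<lbrakk>p tagged_partial_division_of (cbox a b); \<gamma> fine p\<rbrakk> \<Longrightarrow>
             sum (\<lambda>(x,k). norm(measure lborel k *\<^sub>R f x - integral k f)) p < e / 2 * \<alpha>"
    by blast
  \<comment> \<open>Vitali's theorem selects balls, Henstock's lemma wants tagged intervals:
    \<open>I (x,y)\<close> spans one half of the ball about its tag \<open>x\<close> that reaches to
    \<open>y\<close>. Disjoint balls thus give nonoverlapping intervals.\<close>
  define I where "I = (\<lambda>(x::real,y::real). {min x y..max x y})"
  define bad where "bad = (\<lambda>(x,y). \<alpha> * \<bar>y - x\<bar> < \<bar>integral {a..y} f - integral {a..x} f - (y - x) * f x\<bar>)"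
  define K where "K = {(x,y). x \<in> ?S \<and> y \<in> {a..b} \<and> 0 < \<bar>y - x\<bar> \<and> I (x,y) \<subseteq> \<gamma> x \<and> bad (x,y)}"
  define r where "r = (\<lambda>(x::real,y). \<bar>y - x\<bar>)"
  have cover: "\<exists>i. i \<in> K \<and> x \<in> ball (fst i) (r i) \<and> r i < d" if x: "x \<in> ?S" and "0 < d" for x d
  proof -
    from gaugeD[OF \<gamma>, of x] obtain \<delta> where \<delta>: "0 < \<delta>" "ball x \<delta> \<subseteq> \<gamma> x"
      using openE by blast
    have "0 < min \<delta> d" using \<delta> \<open>0 < d\<close> by simp
    with x obtain y where y: "y \<in> {a..b}" "0 < \<bar>y - x\<bar>" "\<bar>y - x\<bar> < min \<delta> d" "bad (x,y)"
      unfolding bad_def prod.case by blast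
    have "I (x,y) \<subseteq> ball x \<delta>" using y by (auto simp: I_def dist_real_def)
    with \<delta> x y have "(x,y) \<in> K" by (auto simp: K_def)
    with y show ?thesis by (intro exI[of _ "(x,y)"]) (auto simp: r_def)
  qed
  obtain C where C: "countable C" "C \<subseteq> K"
     and dis: "pairwise (\<lambda>i j. disjnt (ball (fst i) (r i)) (ball (fst j) (r j))) C"
     and neg: "negligible (?S - (\<Union>i \<in> C. ball (fst i) (r i)))"
    using Vitali_covering_theorem_balls[of ?S K fst r] cover by blast
  have inner: "(\<Sum>i\<in>F. r i) \<le> e / 2" if F: "F \<subseteq> C" "finite F" for F
  proof -
    define p where "p = (\<lambda>i. (fst i, I i)) ` F"
    have FK: "x \<in> {a..b} \<and> y \<in> {a..b} \<and> x \<noteq> y \<and> I (x,y) \<subseteq> \<gamma> x \<and> bad (x,y)" if "(x,y) \<in> F" for x y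
    proof -
      from that F C have "(x,y) \<in> K" by blast
      then show ?thesis by (simp add: K_def)
    qed
    have rpos: "0 < r i" if "i \<in> F" for i
      using FK[of "fst i" "snd i"] that by (simp add: r_def split_beta)
    have int: "interior (I i) \<subseteq> ball (fst i) (r i)" if "i \<in> F" for i
      by (cases i) (auto simp: I_def r_def dist_real_def)
    \<comment> \<open>Balls with a common centre meet, so selected pairs have distinct tags, and the
      Henstock sum can be reindexed by \<open>F\<close>.\<close>
    have eqI: "i = j" if "i \<in> F" "j \<in> F" "fst i = fst j" for i j
    proof (rule ccontr)
      assume "i \<noteq> j"
      with F that have "disjnt (ball (fst i) (r i)) (ball (fst j) (r j))"
        by (intro pairwiseD[OF dis]) auto
      with that rpos[OF that(1)] rpos[OF that(2)] show False
        by (auto simp: disjnt_iff) (metis dist_self)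
    qed
    have inj: "inj_on (\<lambda>i. (fst i, I i)) F"
      using eqI by (auto simp: inj_on_def)
    have "p tagged_partial_division_of (cbox a b)"
      unfolding tagged_partial_division_of_def
    proof (intro conjI allI impI)
      show "finite p" using F by (simp add: p_def)
    next
      fix x L assume "(x, L) \<in> p"
      then obtain y where "(x,y) \<in> F" "L = I (x,y)" by (auto simp: p_def)
      with FK[of x y] have "x \<in> {a..b}" "y \<in> {a..b}" "L = {min x y..max x y}" by (simp_all add: I_def)
      then show "x \<in> L" "L \<subseteq> cbox a b" "\<exists>a b. L = cbox a b" 
        by (auto intro: exI[of _ "min x y"] exI[of _ "max x y"])
    next
      fix x1 K1 x2 K2 assume "(x1,K1) \<in> p \<and> (x2,K2) \<in> p \<and> (x1,K1) \<noteq> (x2,K2)"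
      then obtain i j where ij: "i \<in> F" "j \<in> F" "K1 = I i" "K2 = I j" "i \<noteq> j"
        by (auto simp: p_def)
      with F have "disjnt (ball (fst i) (r i)) (ball (fst j) (r j))"
        by (intro pairwiseD[OF dis]) auto
      with int[of i] int[of j] ij show "interior K1 \<inter> interior K2 = {}"
        by (auto simp: disjnt_def)
    qed
    moreover have "\<gamma> fine p"
      unfolding fine_def p_def using FK by fastforce
    ultimately have "sum (\<lambda>(x,k). norm(measure lborel k *\<^sub>R f x - integral k f)) p < e / 2 * \<alpha>"
      by (rule hen)
    moreover have "sum (\<lambda>(x,k). norm(measure lborel k *\<^sub>R f x - integral k f)) p
        = (\<Sum>i\<in>F. norm (measure lborel (I i) *\<^sub>R f (fst i) - integral (I i) f))"
      unfolding p_def by (subst sum.reindex[OF inj]) (simp add: o_def)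
    moreover have "(\<Sum>i\<in>F. \<alpha> * r i) \<le> (\<Sum>i\<in>F. norm (measure lborel (I i) *\<^sub>R f (fst i) - integral (I i) f))"
    proof (rule sum_mono)
      fix i assume i: "i \<in> F"
      obtain x y where xy: "i = (x,y)" by (cases i)
      with i FK[of x y] have h: "x \<in> {a..b}" "y \<in> {a..b}" "bad (x,y)" by simp_all
      have comb: "integral {a..d} f - integral {a..c} f = integral {c..d} f"
        if "a \<le> c" "c \<le> d" "d \<le> b" for c d
        using Henstock_Kurzweil_Integration.integral_combine[of a c d f] that
          integrable_subinterval_real[OF f, of a d] by auto
      show "\<alpha> * r i \<le> norm (measure lborel (I i) *\<^sub>R f (fst i) - integral (I i) f)"
      proof (cases "x \<le> y")
        case True
        then show ?thesis using h comb[of x y] by (auto simp: xy I_def r_def bad_def min_def max_def abs_minus_commute)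
      next
        case False
        then have "integral {y..x} f = integral {a..x} f - integral {a..y} f" using h comb[of y x] by auto
        then show ?thesis using h False by (auto simp: xy I_def r_def bad_def min_def max_def algebra_simps)
      qed
    qed
    ultimately have "\<alpha> * (\<Sum>i\<in>F. r i) < e / 2 * \<alpha>" by (simp add: sum_distrib_left)
    with \<open>0 < \<alpha>\<close> show ?thesis by (simp add: mult.commute)
  qed
  have bnd: "measure lebesgue (\<Union>i\<in>F. ball (fst i) (r i)) \<le> e" if F: "F \<subseteq> C" "finite F" for F
  proof -
    have "measure lebesgue (\<Union>i\<in>F. ball (fst i) (r i)) \<le> (\<Sum>i\<in>F. measure lebesgue (ball (fst i) (r i)))"
      using F by (intro measure_UNION_le) auto
    also have "\<dots> = (\<Sum>i\<in>F. 2 * r i)"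
    proof (rule sum.cong[OF refl])
      fix i assume "i \<in> F"
      then have "0 < r i" using F C by (auto simp: K_def r_def)
      then show "measure lebesgue (ball (fst i) (r i)) = 2 * r i"
        by (simp add: ball_eq_greaterThanLessThan)
    qed
    finally show ?thesis using inner[OF F] by (simp add: sum_distrib_left[symmetric])
  qed
  let ?U = "\<Union>i\<in>C. ball (fst i) (r i)"
  have U: "?U \<in> lmeasurable" "measure lebesgue ?U \<le> e"
    using fmeasurable_UN_bound[OF C(1) _ bnd] measure_UN_bound[OF C(1) _ bnd] by auto
  obtain N where N: "negligible N" "?S \<subseteq> ?U \<union> N"
    using neg by blast
  then have mN: "N \<in> lmeasurable" "measure lebesgue N = 0"
    by (simp_all add: negligible_iff_measure)
  moreover have "measure lebesgue (?U \<union> N) \<le> e"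
    using measure_Un_le[of ?U lebesgue N] U mN by (simp add: fmeasurableD)
  ultimately show "\<exists>T. ?S \<subseteq> T \<and> T \<in> lmeasurable \<and> measure lebesgue T \<le> e"
    using N(2) U(1) by (intro exI[of _ "?U \<union> N"] conjI fmeasurable.Un)
qed

text \<open>If the derivative at \<open>x\<close> fails to be \<open>f x\<close>, the error exceeds
  a fixed multiple \<open>inverse (Suc n)\<close> of the increment arbitrarily close to
  \<open>x\<close>; the exceptional set is a countable union of negligible bad sets.\<close>

lemma lebesgue_differentiation:
  fixes f :: "real \<Rightarrow> real"
  assumes f: "f integrable_on {a..b}"
  shows "AE x in lebesgue. a < x \<longrightarrow> x < b \<longrightarrow> ((\<lambda>t. integral {a..t} f) has_real_derivative f x) (at x)"
proof -
  define S where "S \<alpha> = {x \<in> {a<..<b}. \<forall>\<delta>>0. \<exists>y\<in>{a..b}. 0 < \<bar>y - x\<bar> \<and> \<bar>y - x\<bar> < \<delta> \<and>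
           \<alpha> * \<bar>y - x\<bar> < \<bar>integral {a..y} f - integral {a..x} f - (y - x) * f x\<bar>}" for \<alpha>
  have "negligible (\<Union>n. S (inverse (real (Suc n))))"
  proof (rule negligible_countable_Union)
    fix T assume "T \<in> range (\<lambda>n. S (inverse (real (Suc n))))"
    then obtain n where "T = S (inverse (real (Suc n)))" by blast
    moreover have "0 < inverse (real (Suc n))" by simp
    ultimately show "negligible T"
      using negligible_bad_difference_quotients[OF f] by (simp only: S_def)
  qed simp
  moreover have "((\<lambda>t. integral {a..t} f) has_real_derivative f x) (at x)"
    if x: "x \<notin> (\<Union>n. S (inverse (real (Suc n))))" "a < x" "x < b" for x
    unfolding has_field_derivative_def has_derivative_at_alt
  proof (intro conjI allI impI bounded_linear_mult_right)
    fix e :: real assume "0 < e"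
    then obtain n where n: "inverse (real (Suc n)) < e" using reals_Archimedean by blast
    from x have "x \<notin> S (inverse (real (Suc n)))" by blast
    with x(2,3) obtain \<delta> where "0 < \<delta>" and \<delta>: "\<And>y. \<lbrakk>y \<in> {a..b}; 0 < \<bar>y - x\<bar>; \<bar>y - x\<bar> < \<delta>\<rbrakk> \<Longrightarrow>
      \<not> inverse (real (Suc n)) * \<bar>y - x\<bar> < \<bar>integral {a..y} f - integral {a..x} f - (y - x) * f x\<bar>"
      unfolding S_def mem_Collect_eq greaterThanLessThan_iff by blast
    show "\<exists>d>0. \<forall>y. norm (y - x) < d \<longrightarrow> norm (integral {a..y} f - integral {a..x} f - f x * (y - x)) \<le> e * norm (y - x)"
    \<comment> \<open>The distances to the endpoints keep \<open>y\<close> inside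
      \<open>{a..b}\<close>, where alone \<open>S\<close> tests the quotient.\<close>
    proof (intro exI[of _ "min \<delta> (min (x - a) (b - x))"] conjI allI impI)
      show "0 < min \<delta> (min (x - a) (b - x))" using \<open>0 < \<delta>\<close> x(2,3) by simp
    next
      fix y assume y: "norm (y - x) < min \<delta> (min (x - a) (b - x))"
      show "norm (integral {a..y} f - integral {a..x} f - f x * (y - x)) \<le> e * norm (y - x)"
      proof (cases "y = x")
        case False
        with y have "\<bar>integral {a..y} f - integral {a..x} f - (y - x) * f x\<bar> \<le> inverse (real (Suc n)) * \<bar>y - x\<bar>"
          using \<delta>[of y] by (auto simp: not_less abs_less_iff)
        also have "\<dots> \<le> e * \<bar>y - x\<bar>" using n by (intro mult_right_mono) auto
        finally show ?thesis by (simp add: mult.commute)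
      qed simp
    qed
  qed
  ultimately show ?thesis
    by (intro AE_I'[of "\<Union>n. S (inverse (real (Suc n)))"]) (simp only: negligible_iff_null_sets, blast)
qed

section \<open>Densities of absolutely continuous functions\<close>

text \<open>The arbitrary index type lets families of intervals be indexed by pairs.\<close>

definition small_variation :: "(real \<Rightarrow> real) \<Rightarrow> real \<Rightarrow> real \<Rightarrow> 'i set \<Rightarrow> bool" where
  "small_variation v \<epsilon> \<delta> (J :: 'i set) \<longleftrightarrow>
     (\<forall>x y. (\<forall>i\<in>J. x i \<le> y i) \<longrightarrow> (\<forall>i\<in>J. \<forall>j\<in>J. i \<noteq> j \<longrightarrow> y i \<le> x j \<or> y j \<le> x i) \<longrightarrow>
        (\<Sum>i\<in>J. y i - x i) < \<delta> \<longrightarrow> (\<Sum>i\<in>J. \<bar>v (y i) - v (x i)\<bar>) < \<epsilon>)"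

text \<open>Continuing \<open>u\<close> by constants outside \<open>[0, T]\<close> frees the
  families of intervals from any containment condition.\<close>

definition clamp_ext :: "real \<Rightarrow> (real \<Rightarrow> real) \<Rightarrow> real \<Rightarrow> real" where
  "clamp_ext T u t = u (max 0 (min T t))"

lemma sum_diff_clamp_le:
  assumes "finite J" "\<And>i. i \<in> J \<Longrightarrow> x i \<le> (y i :: real)"
  shows "(\<Sum>i\<in>J. max a (min b (y i)) - max a (min b (x i))) \<le> (\<Sum>i\<in>J. y i - x i)"
  by (rule sum_mono) (use assms(2) in \<open>fastforce simp: max_def min_def\<close>)

text \<open>Clamping to \<open>[0, T]\<close> is monotone and does not lengthen intervals, so the
  \<open>\<delta>\<close> of the definition serves every finite family, whatever its index
  set.\<close>

lemma abs_cont_on_imp_small_variation: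
  assumes ac: "abs_cont_on 0 T u" and "0 \<le> T" and "0 < \<epsilon>"
  shows "\<exists>\<delta>>0. \<forall>J :: 'i set. finite J \<longrightarrow> small_variation (clamp_ext T u) \<epsilon> \<delta> J"
proof -
  from ac \<open>0 < \<epsilon>\<close> obtain \<delta> where "0 < \<delta>" and \<delta>: "\<And>(n::nat) (x::nat \<Rightarrow> real) (y::nat \<Rightarrow> real).
        (\<forall>i<n. 0 \<le> x i \<and> x i \<le> y i \<and> y i \<le> T) \<and>
        (\<forall>i<n. \<forall>j<n. i \<noteq> j \<longrightarrow> y i \<le> x j \<or> y j \<le> x i) \<and>
        (\<Sum>i<n. y i - x i) < \<delta> \<Longrightarrow> (\<Sum>i<n. \<bar>u (y i) - u (x i)\<bar>) < \<epsilon>"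
    unfolding abs_cont_on_def by blast
  have "small_variation (clamp_ext T u) \<epsilon> \<delta> J" if "finite J" for J :: "'i set"
    unfolding small_variation_def
  proof (intro allI impI)
    fix x y assume le: "\<forall>i\<in>J. x i \<le> y i" and dis: "\<forall>i\<in>J. \<forall>j\<in>J. i \<noteq> j \<longrightarrow> y i \<le> x j \<or> y j \<le> x i"
      and sm: "(\<Sum>i\<in>J. y i - x i) < \<delta>"
    obtain h where h: "bij_betw h {..<card J} J"
      using ex_bij_betw_nat_finite[OF \<open>finite J\<close>] by (auto simp: atLeast0LessThan)
    define cl where "cl t = max 0 (min T t)" for t :: real
    have mono: "cl s \<le> cl t" if "s \<le> t" for s t using that by (auto simp: cl_def)
    have hJ: "h i \<in> J" if "i < card J" for i using h that by (auto simp: bij_betw_def)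
    have hne: "h i \<noteq> h j" if "i < card J" "j < card J" "i \<noteq> j" for i j
      using h that by (auto simp: bij_betw_def inj_on_def)
    have "(\<Sum>i<card J. \<bar>u (cl (y (h i))) - u (cl (x (h i)))\<bar>) < \<epsilon>"
    proof (intro \<delta> conjI allI impI)
      fix i assume i: "i < card J"
      show "0 \<le> cl (x (h i))" "cl (y (h i)) \<le> T" using \<open>0 \<le> T\<close> by (auto simp: cl_def)
      show "cl (x (h i)) \<le> cl (y (h i))" using le hJ[OF i] by (intro mono) auto
      fix j assume j: "j < card J" and "i \<noteq> j"
      with dis hJ[OF i] hJ[OF j] hne[OF i j] have "y (h i) \<le> x (h j) \<or> y (h j) \<le> x (h i)" by blast
      then show "cl (y (h i)) \<le> cl (x (h j)) \<or> cl (y (h j)) \<le> cl (x (h i))" using mono by blast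
    next
      have "(\<Sum>i<card J. cl (y (h i)) - cl (x (h i))) = (\<Sum>i\<in>J. cl (y i) - cl (x i))"
        by (rule sum.reindex_bij_betw[OF h])
      also have "\<dots> \<le> (\<Sum>i\<in>J. y i - x i)"
        unfolding cl_def by (rule sum_diff_clamp_le) (use \<open>finite J\<close> le in auto)
      also have "\<dots> < \<delta>" by (rule sm)
      finally show "(\<Sum>i<card J. cl (y (h i)) - cl (x (h i))) < \<delta>" .
    qed
    also have "(\<Sum>i<card J. \<bar>u (cl (y (h i))) - u (cl (x (h i)))\<bar>) = (\<Sum>i\<in>J. \<bar>u (cl (y i)) - u (cl (x i))\<bar>)"
      by (rule sum.reindex_bij_betw[OF h])
    finally show "(\<Sum>i\<in>J. \<bar>clamp_ext T u (y i) - clamp_ext T u (x i)\<bar>) < \<epsilon>"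
      by (simp add: clamp_ext_def cl_def)
  qed
  with \<open>0 < \<delta>\<close> show ?thesis by blast
qed

section \<open>Positive variation along dyadic grids\<close>

text \<open>The positive variation over the dyadic grid of step \<open>T / 2 ^ n\<close>, stopped at \<open>t\<close>.\<close>

definition dyadic_var :: "real \<Rightarrow> (real \<Rightarrow> real) \<Rightarrow> nat \<Rightarrow> real \<Rightarrow> real" where
  "dyadic_var T v n t =
     (\<Sum>j<2^n. max 0 (v (min t (real (Suc j) * T / 2^n)) - v (min t (real j * T / 2^n))))"

lemma grid_mono: "0 \<le> T \<Longrightarrow> i \<le> j \<Longrightarrow> real i * T / 2^n \<le> real j * T / 2^n"
  by (simp add: divide_right_mono mult_right_mono)

lemma sum_double: "(\<Sum>j<2 * m. f j) = (\<Sum>j<m. f (2 * j) + f (Suc (2 * j)))" for f :: "nat \<Rightarrow> real"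
  by (induction m) simp_all

text \<open>Halving a cell splits its increment into two summands, and the positive part is
  subadditive.\<close>

lemma dyadic_var_Suc: "dyadic_var T v n t \<le> dyadic_var T v (Suc n) t"
proof -
  have "dyadic_var T v (Suc n) t = (\<Sum>j<2^n.
      max 0 (v (min t (real (Suc (2 * j)) * T / 2^Suc n)) - v (min t (real (2 * j) * T / 2^Suc n)))
    + max 0 (v (min t (real (Suc (Suc (2 * j))) * T / 2^Suc n)) - v (min t (real (Suc (2 * j)) * T / 2^Suc n))))"
    unfolding dyadic_var_def power_Suc by (rule sum_double)
  also have "\<dots> \<ge> dyadic_var T v n t"
    unfolding dyadic_var_def
  proof (rule sum_mono)
    fix j :: nat
    have "real (2 * j) * T / 2^Suc n = real j * T / 2^n"
         "real (Suc (Suc (2 * j))) * T / 2^Suc n = real (Suc j) * T / 2^n"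
      by (simp_all add: field_simps)
    then show "max 0 (v (min t (real (Suc j) * T / 2^n)) - v (min t (real j * T / 2^n)))
     \<le> max 0 (v (min t (real (Suc (2 * j)) * T / 2^Suc n)) - v (min t (real (2 * j) * T / 2^Suc n)))
    + max 0 (v (min t (real (Suc (Suc (2 * j))) * T / 2^Suc n)) - v (min t (real (Suc (2 * j)) * T / 2^Suc n)))"
      by (simp only:) linarith
  qed
  finally show ?thesis .
qed

text \<open>Moving the stopping point from \<open>s\<close> to \<open>t\<close> changes the value of
  \<open>v\<close> at each stopped grid point by an increment inside \<open>[s, t]\<close>, and the
  positive part is 1-Lipschitz. Growth of the positive variation is thus controlled by the variation
  of \<open>v\<close> over the cells clipped to \<open>[s, t]\<close>.\<close>

lemma dyadic_var_diff_le:
  assumes "s \<le> t"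
  shows "dyadic_var T v n t - dyadic_var T v n s \<le>
    (\<Sum>j<2^n. \<bar>v (max s (min t (real (Suc j) * T / 2^n))) - v (max s (min t (real j * T / 2^n)))\<bar>)"
  unfolding dyadic_var_def sum_subtractf[symmetric]
proof (rule sum_mono)
  fix j :: nat
  have split: "v (min t z) = v (min s z) + v (max s (min t z)) - v s" for z
    using assms by (cases "z \<le> s") (auto simp: min_def max_def)
  have aux: "max 0 (a' - b') - max 0 (a - b) \<le> \<bar>p - q\<bar>"
    if "a' = a + p - r" "b' = b + q - r" for a a' b b' p q r :: real
    using that by linarith
  show "max 0 (v (min t (real (Suc j) * T / 2^n)) - v (min t (real j * T / 2^n)))
      - max 0 (v (min s (real (Suc j) * T / 2^n)) - v (min s (real j * T / 2^n)))
      \<le> \<bar>v (max s (min t (real (Suc j) * T / 2^n))) - v (max s (min t (real j * T / 2^n)))\<bar>"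
    by (rule aux[OF split split])
qed

text \<open>The grid cells clipped to the given intervals form a family indexed by pairs whose total
  length does not exceed the original one. The bound obtained is the same for every grid, so it
  survives the limit in \<open>n\<close>.\<close>

lemma dyadic_var_family:
  assumes "0 \<le> T" "finite J"
    and le: "\<And>i. i \<in> J \<Longrightarrow> x i \<le> y i"
    and dis: "\<And>i j. i \<in> J \<Longrightarrow> j \<in> J \<Longrightarrow> i \<noteq> j \<Longrightarrow> y i \<le> x j \<or> y j \<le> x i"
    and small: "(\<Sum>i\<in>J. y i - x i) < \<delta>"
    and v: "small_variation v \<epsilon> \<delta> (J \<times> {..<2^n :: nat})"
  shows "(\<Sum>i\<in>J. dyadic_var T v n (y i) - dyadic_var T v n (x i)) < \<epsilon>"
proof -
  define c where "c j = real j * T / 2^n" for j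
  have cm: "c i \<le> c j" if "i \<le> j" for i j using grid_mono[OF \<open>0 \<le> T\<close> that] by (simp add: c_def)
  \<comment> \<open>A cell that misses \<open>[x i, y i]\<close> collapses to an endpoint, with
    \<open>X = Y\<close>, and contributes nothing.\<close>
  define X where "X = (\<lambda>(i,j). max (x i) (min (y i) (c j)))"
  define Y where "Y = (\<lambda>(i,j). max (x i) (min (y i) (c (Suc j))))"
  have "(\<Sum>i\<in>J. dyadic_var T v n (y i) - dyadic_var T v n (x i)) \<le> (\<Sum>i\<in>J. \<Sum>j<2^n. \<bar>v (Y (i,j)) - v (X (i,j))\<bar>)"
    using dyadic_var_diff_le[OF le] by (intro sum_mono) (simp add: X_def Y_def c_def)
  also have "\<dots> = (\<Sum>p\<in>J \<times> {..<2^n}. \<bar>v (Y p) - v (X p)\<bar>)"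
    by (simp add: sum.cartesian_product split_def)
  also have "\<dots> < \<epsilon>"
  proof (rule v[unfolded small_variation_def, rule_format])
    fix p assume "p \<in> J \<times> {..<2^n :: nat}"
    then show "X p \<le> Y p" using cm[of "snd p" "Suc (snd p)"] by (auto simp: X_def Y_def split_beta max_def min_def)
  next
    fix p q assume pq: "p \<in> J \<times> {..<2^n :: nat}" "q \<in> J \<times> {..<2^n :: nat}" "p \<noteq> q"
    obtain i j k l where ij: "p = (i,j)" "q = (k,l)" by (metis surj_pair)
    have B: "x i \<le> X (i,j)" "Y (i,j) \<le> y i" if "i \<in> J" for i j
      using le[OF that] by (auto simp: X_def Y_def)
    show "Y p \<le> X q \<or> Y q \<le> X p"
    proof (cases "i = k")
      case False
      then have "y i \<le> x k \<or> y k \<le> x i" using pq ij dis by auto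
      then show ?thesis using B[of i j] B[of k l] B[of i l] B[of k j] pq ij by force
    next
      case True
      with pq ij have "Suc j \<le> l \<or> Suc l \<le> j" by auto
      then show ?thesis
      proof
        assume "Suc j \<le> l"
        then have "Y p \<le> X q" using cm[of "Suc j" l] unfolding ij X_def Y_def prod.case True by (intro max.mono min.mono order_refl)
        then show ?thesis ..
      next
        assume "Suc l \<le> j"
        then have "Y q \<le> X p" using cm[of "Suc l" j] unfolding ij X_def Y_def prod.case True by (intro max.mono min.mono order_refl)
        then show ?thesis ..
      qed
    qed
  next
    have "(\<Sum>p\<in>J \<times> {..<2^n}. Y p - X p) = (\<Sum>i\<in>J. \<Sum>j<2^n. Y (i,j) - X (i,j))"
      by (simp add: sum.cartesian_product split_def)
    also have "\<dots> \<le> (\<Sum>i\<in>J. y i - x i)"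
    proof (rule sum_mono)
      fix i assume i: "i \<in> J"
      have "(\<Sum>j<2^n. Y (i,j) - X (i,j)) = max (x i) (min (y i) (c (2^n))) - max (x i) (min (y i) (c 0))"
        unfolding X_def Y_def prod.case by (rule sum_lessThan_telescope)
      also have "\<dots> \<le> y i - x i" using le[OF i] by (simp add: max_def min_def)
      finally show "(\<Sum>j<2^n. Y (i,j) - X (i,j)) \<le> y i - x i" .
    qed
    finally show "(\<Sum>p\<in>J \<times> {..<2^n}. Y p - X p) < \<delta>" using small by simp
  qed
  finally show ?thesis .
qed

lemma dyadic_var_0: "0 \<le> T \<Longrightarrow> t \<le> 0 \<Longrightarrow> dyadic_var T v n t = 0"
  unfolding dyadic_var_def
proof (rule sum.neutral, intro ballI)
  fix j assume "0 \<le> T" "t \<le> 0"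
  then have "t \<le> real (Suc j) * T / 2^n" "t \<le> real j * T / 2^n"
    by (meson divide_nonneg_nonneg mult_nonneg_nonneg of_nat_0_le_iff order_trans zero_le_numeral zero_le_power)+
  then show "max 0 (v (min t (real (Suc j) * T / 2^n)) - v (min t (real j * T / 2^n))) = 0"
    by (simp only: min_absorb1)
qed

text \<open>Discrete Jordan decomposition: positive part minus negative part of an increment is the
  increment itself, and the increments telescope.\<close>

lemma dyadic_var_diff_uminus:
  "dyadic_var T v n t - dyadic_var T (\<lambda>x. - v x) n t = v (min t T) - v (min t 0)"
proof -
  have "dyadic_var T v n t - dyadic_var T (\<lambda>x. - v x) n t
     = (\<Sum>j<2^n. v (min t (real (Suc j) * T / 2^n)) - v (min t (real j * T / 2^n)))"
    unfolding dyadic_var_def sum_subtractf[symmetric] by (rule sum.cong) auto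
  also have "\<dots> = v (min t (real (2^n) * T / 2^n)) - v (min t (real 0 * T / 2^n))"
    by (rule sum_lessThan_telescope)
  finally show ?thesis by simp
qed

text \<open>For fixed \<open>n\<close> the variation is not monotone in the stopping point. Cells
  ending before \<open>s\<close> contribute equally to both sides and cells beginning after
  \<open>s\<close> contribute nothing at \<open>s\<close>; only the cell with \<open>s\<close> in
  its interior can lose, and at most the oscillation \<open>\<epsilon>\<close>.\<close>

lemma dyadic_var_almost_mono:
  assumes "0 \<le> T" "s \<le> t" and "0 \<le> \<epsilon>"
    and osc: "\<And>c. c \<le> s \<Longrightarrow> s - c < T / 2^n \<Longrightarrow> \<bar>v s - v c\<bar> \<le> \<epsilon>"
  shows "dyadic_var T v n s \<le> dyadic_var T v n t + \<epsilon>"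
proof -
  define c where "c j = real j * T / 2^n" for j
  have cm: "c i \<le> c j" if "i \<le> j" for i j using grid_mono[OF \<open>0 \<le> T\<close> that] by (simp add: c_def)
  have cS: "c (Suc j) = c j + T / 2^n" for j by (simp add: c_def field_simps)
  let ?A = "{j. j < 2^n \<and> c j < s \<and> s < c (Suc j)}"
  have "card ?A \<le> Suc 0"
  proof (subst card_le_Suc0_iff_eq, simp, intro ballI, rule ccontr)
    fix i j assume "i \<in> ?A" "j \<in> ?A" "i \<noteq> j"
    then show False using cm[of "Suc i" j] cm[of "Suc j" i] by (cases i j rule: linorder_cases) auto
  qed
  have "dyadic_var T v n s - dyadic_var T v n t \<le> (\<Sum>j<2^n. if j \<in> ?A then \<epsilon> else 0)"
    unfolding dyadic_var_def sum_subtractf[symmetric] c_def[symmetric]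
  proof (rule sum_mono)
    fix j :: nat assume j: "j \<in> {..<2^n}"
    consider "c (Suc j) \<le> s" | "s \<le> c j" | "c j < s" "s < c (Suc j)" by linarith
    then show "max 0 (v (min s (c (Suc j))) - v (min s (c j))) - max 0 (v (min t (c (Suc j))) - v (min t (c j)))
       \<le> (if j \<in> ?A then \<epsilon> else 0)"
    proof cases
      case 1
      then show ?thesis using cm[of j "Suc j"] \<open>s \<le> t\<close> \<open>0 \<le> \<epsilon>\<close> by simp
    next
      case 2
      then show ?thesis using cm[of j "Suc j"] \<open>0 \<le> \<epsilon>\<close> by simp
    next
      case 3
      then have "\<bar>v s - v (c j)\<bar> \<le> \<epsilon>" by (intro osc) (auto simp: cS)
      with 3 j show ?thesis by (auto simp: max_def)
    qed
  qed
  also have "\<dots> = real (card ?A) * \<epsilon>"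
    by (simp add: sum.If_cases Int_def)
  also have "\<dots> \<le> 1 * \<epsilon>" using \<open>card ?A \<le> Suc 0\<close> \<open>0 \<le> \<epsilon>\<close> by (intro mult_right_mono) auto
  finally show ?thesis by simp
qed

lemma dyadic_var_min:
  assumes "0 \<le> T"
  shows "dyadic_var T v n (min t T) = dyadic_var T v n t"
proof -
  have *: "min (min t T) (real j * T / 2^n) = min t (real j * T / 2^n)" if "j \<le> 2^n" for j
  proof -
    have "real j * T / 2^n \<le> real (2^n) * T / 2^n" by (rule grid_mono[OF assms that])
    then show ?thesis by (simp add: min.assoc min.absorb2)
  qed
  show ?thesis unfolding dyadic_var_def by (intro sum.cong refl) (simp add: * del: of_nat_Suc)
qed

lemma ex_grid_finer: "0 < \<delta> \<Longrightarrow> \<exists>n. T / 2^n < (\<delta>::real)"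
proof -
  assume "0 < \<delta>"
  have "(\<lambda>n. T * (1/2)^n) \<longlonglongrightarrow> T * 0" by (intro tendsto_intros LIMSEQ_power_zero) simp
  then have "eventually (\<lambda>n. T * (1/2)^n < \<delta>) sequentially"
    using \<open>0 < \<delta>\<close> by (intro order_tendstoD) simp_all
  then show ?thesis by (auto simp: eventually_sequentially power_one_over)
qed

text \<open>Cut \<open>[0, T]\<close> into \<open>2^m\<close> pieces shorter than the
  \<open>\<delta>\<close> that belongs to \<open>\<epsilon> = 1\<close>: each piece adds at most 1,
  at every level \<open>n\<close>.\<close>

lemma dyadic_var_bounded:
  assumes ac: "abs_cont_on 0 T u" and "0 < T"
  shows "\<exists>B. \<forall>n t. dyadic_var T (clamp_ext T u) n t \<le> B"
proof -
  let ?v = "clamp_ext T u"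
  obtain \<delta> where "0 < \<delta>" and \<delta>: "\<And>J :: (unit \<times> nat) set. finite J \<Longrightarrow> small_variation ?v 1 \<delta> J"
    using abs_cont_on_imp_small_variation[OF ac less_imp_le[OF \<open>0 < T\<close>] zero_less_one,
      where ?'i = "unit \<times> nat"] by blast
  obtain m where m: "T / 2^m < \<delta>" using ex_grid_finer[OF \<open>0 < \<delta>\<close>] by blast
  have "dyadic_var T ?v n t \<le> 2^m" for n t
  proof -
    define c where "c j = real j * T / 2^m" for j
    define D where "D = dyadic_var T ?v n"
    have step: "D (min t (c (Suc j))) - D (min t (c j)) \<le> 1" for j
    proof -
      have "c j \<le> c (Suc j)" "c (Suc j) - c j = T / 2^m"
        using \<open>0 < T\<close> by (simp_all add: c_def field_simps)
      then have "(\<Sum>i\<in>{()}. D (min t (c (Suc j))) - D (min t (c j))) < 1"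
        unfolding D_def using \<open>0 < T\<close> m
        by (intro dyadic_var_family[where \<delta>=\<delta>] \<delta>) (auto simp: min_def)
      then show ?thesis by simp
    qed
    have "D t = D (min t (c (2^m))) - D (min t (c 0))"
      using dyadic_var_min[of T ?v n t] dyadic_var_0[of T "min t 0" ?v n] \<open>0 < T\<close> by (simp add: D_def c_def)
    also have "\<dots> = (\<Sum>j<2^m. D (min t (c (Suc j))) - D (min t (c j)))"
      by (rule sum_lessThan_telescope[symmetric])
    also have "\<dots> \<le> (\<Sum>j<2^m::nat. 1)" by (intro sum_mono step)
    finally show ?thesis by (simp add: D_def)
  qed
  then show ?thesis by blast
qed

text \<open>Meant for nondecreasing \<open>F\<close>, hence no absolute values; the bound is not
  strict because it is obtained as a limit. The index type does not occur in \<open>F\<close> and is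
  therefore passed as an argument.\<close>

definition abs_cont_families :: "'i itself \<Rightarrow> (real \<Rightarrow> real) \<Rightarrow> bool" where
  "abs_cont_families (_ :: 'i itself) F \<longleftrightarrow> (\<forall>\<epsilon>>0. \<exists>\<delta>>0. \<forall>(J :: 'i set) x y. finite J \<longrightarrow> (\<forall>i\<in>J. x i \<le> y i) \<longrightarrow>
     (\<forall>i\<in>J. \<forall>j\<in>J. i \<noteq> j \<longrightarrow> y i \<le> x j \<or> y j \<le> x i) \<longrightarrow> (\<Sum>i\<in>J. y i - x i) < \<delta> \<longrightarrow>
     (\<Sum>i\<in>J. F (y i) - F (x i)) \<le> \<epsilon>)"

text \<open>For each \<open>t\<close> the stages increase with \<open>n\<close> and stay bounded.
  Monotonicity in \<open>t\<close> holds at a stage only up to the oscillation over one grid step,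
  an error that disappears in the limit.\<close>

lemma positive_variation:
  assumes ac: "abs_cont_on 0 T u" and "0 < T"
  obtains P where "\<And>t. (\<lambda>n. dyadic_var T (clamp_ext T u) n t) \<longlonglongrightarrow> P t" "mono P"
    "abs_cont_families TYPE('i) P"
proof -
  let ?v = "clamp_ext T u" and ?D = "dyadic_var T (clamp_ext T u)"
  have "\<exists>p. (\<lambda>n. ?D n t) \<longlonglongrightarrow> p" for t
  proof -
    obtain B where B: "\<And>n t. ?D n t \<le> B" using dyadic_var_bounded[OF assms] by blast
    show ?thesis
      using incseq_convergent[of "\<lambda>n. ?D n t" B] B by (metis dyadic_var_Suc incseq_SucI)
  qed
  then obtain P where P: "\<And>t. (\<lambda>n. ?D n t) \<longlonglongrightarrow> P t" by metis
  moreover have "mono P"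
  proof (intro monoI, rule field_le_epsilon)
    fix s t \<epsilon> :: real assume "s \<le> t" "0 < \<epsilon>"
    obtain \<delta> where "0 < \<delta>" and \<delta>: "\<And>J :: unit set. finite J \<Longrightarrow> small_variation ?v \<epsilon> \<delta> J"
      using abs_cont_on_imp_small_variation[OF ac less_imp_le[OF \<open>0 < T\<close>] \<open>0 < \<epsilon>\<close>,
        where ?'i = "unit"] by blast
    obtain m where m: "T / 2^m < \<delta>" using ex_grid_finer[OF \<open>0 < \<delta>\<close>] by blast
    have "?D n s \<le> ?D n t + \<epsilon>" if "m \<le> n" for n
    proof (rule dyadic_var_almost_mono)
      fix c assume c: "c \<le> s" "s - c < T / 2^n"
      have "T / 2^n \<le> T / 2^m" using that \<open>0 < T\<close> by (intro divide_left_mono) (auto intro: power_increasing)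
      with c m have "s - c < \<delta>" by linarith
      moreover have "small_variation ?v \<epsilon> \<delta> {()}" by (rule \<delta>) simp
      ultimately show "\<bar>?v s - ?v c\<bar> \<le> \<epsilon>"
        using c unfolding small_variation_def
        by (elim allE[of _ "\<lambda>_. c"] allE[of _ "\<lambda>_. s"]) simp
    qed (use \<open>0 < T\<close> \<open>s \<le> t\<close> \<open>0 < \<epsilon>\<close> in auto)
    then show "P s \<le> P t + \<epsilon>"
      by (intro LIMSEQ_le[OF P tendsto_add[OF P tendsto_const]]) blast
  qed
  moreover have "abs_cont_families TYPE('i) P"
    unfolding abs_cont_families_def
  proof (intro allI impI)
    fix \<epsilon> :: real assume "0 < \<epsilon>"
    obtain \<delta> where "0 < \<delta>" and \<delta>: "\<And>J :: ('i \<times> nat) set. finite J \<Longrightarrow> small_variation ?v \<epsilon> \<delta> J"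
      using abs_cont_on_imp_small_variation[OF ac less_imp_le[OF \<open>0 < T\<close>] \<open>0 < \<epsilon>\<close>,
        where ?'i = "'i \<times> nat"] by blast
    have "(\<Sum>i\<in>J. P (y i) - P (x i)) \<le> \<epsilon>" if J: "finite J" "\<forall>i\<in>J. x i \<le> y i"
       "\<forall>i\<in>J. \<forall>j\<in>J. i \<noteq> j \<longrightarrow> y i \<le> x j \<or> y j \<le> x i" "(\<Sum>i\<in>J. y i - x i) < \<delta>" for J :: "'i set" and x y
    proof (rule LIMSEQ_le_const2)
      show "(\<lambda>n. \<Sum>i\<in>J. ?D n (y i) - ?D n (x i)) \<longlonglongrightarrow> (\<Sum>i\<in>J. P (y i) - P (x i))"
        by (intro tendsto_intros P)
      have "(\<Sum>i\<in>J. ?D n (y i) - ?D n (x i)) < \<epsilon>" for n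
        using J \<open>0 < T\<close> by (intro dyadic_var_family[where \<delta>=\<delta>] \<delta>) auto
      then show "\<exists>N. \<forall>n\<ge>N. (\<Sum>i\<in>J. ?D n (y i) - ?D n (x i)) \<le> \<epsilon>" by (meson less_imp_le)
    qed
    with \<open>0 < \<delta>\<close> show "\<exists>\<delta>>0. \<forall>(J :: 'i set) x y. finite J \<longrightarrow> (\<forall>i\<in>J. x i \<le> y i) \<longrightarrow>
     (\<forall>i\<in>J. \<forall>j\<in>J. i \<noteq> j \<longrightarrow> y i \<le> x j \<or> y j \<le> x i) \<longrightarrow> (\<Sum>i\<in>J. y i - x i) < \<delta> \<longrightarrow>
     (\<Sum>i\<in>J. P (y i) - P (x i)) \<le> \<epsilon>" by blast
  qed
  ultimately show thesis by (rule that)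
qed

section \<open>Densities of absolutely continuous monotone functions\<close>

lemma open_connected_bounded_real:
  fixes C :: "real set"
  assumes C: "open C" "connected C" "bounded C" "C \<noteq> {}"
  shows "C = {Inf C<..<Sup C}" and "Inf C < Sup C"
proof -
  have bdd: "bdd_below C" "bdd_above C" using C by (auto intro: bounded_imp_bdd_below bounded_imp_bdd_above)
  show eq: "C = {Inf C<..<Sup C}"
  proof (intro equalityI subsetI)
    fix x assume x: "x \<in> C"
    then obtain e where e: "0 < e" "ball x e \<subseteq> C" using C openE by blast
    then have "x - e/2 \<in> C" "x + e/2 \<in> C" by (auto simp: subset_eq dist_real_def)
    then have "Inf C \<le> x - e/2" "x + e/2 \<le> Sup C" using bdd by (auto intro: cInf_lower cSup_upper)
    with e show "x \<in> {Inf C<..<Sup C}" by auto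
  next
    fix x assume "x \<in> {Inf C<..<Sup C}"
    then obtain c d where "c \<in> C" "c < x" "d \<in> C" "x < d"
      using C bdd by (auto simp: cInf_less_iff less_cSup_iff)
    then show "x \<in> C" using connected_contains_Icc[OF C(2), of c d] by auto
  qed
  then show "Inf C < Sup C" using C(4) by (metis greaterThanLessThan_empty_iff not_less)
qed

text \<open>
  The type \<open>real set\<close> indexes the families by the connected components of an open set of small measure, which
  gives absolute continuity of the Stieltjes measure of \<open>P\<close> and hence a Radon-Nikodym density.
\<close>

lemma mono_abs_cont_density:
  fixes P :: "real \<Rightarrow> real"
  assumes "mono P" and ac: "abs_cont_families TYPE(real set) P"
  obtains g where "g \<in> borel_measurable borel" "\<And>x. 0 \<le> g x"
    "\<And>a b. a \<le> b \<Longrightarrow> set_integrable lborel {a<..b} g"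
    "\<And>a b. a \<le> b \<Longrightarrow> (LINT x:{a<..b}|lborel. g x) = P b - P a"
proof -
  have mono: "P s \<le> P t" if "s \<le> t" for s t using \<open>mono P\<close> that by (rule monoD)
  have osc: "\<exists>\<delta>>0. \<forall>s t. s \<le> t \<longrightarrow> t - s < \<delta> \<longrightarrow> P t - P s \<le> \<epsilon>" if "0 < \<epsilon>" for \<epsilon>
  proof -
    from ac[unfolded abs_cont_families_def, THEN spec, THEN mp, OF that] obtain \<delta> where "0 < \<delta>" and \<delta>: "\<And>(J :: real set set) x y. finite J \<Longrightarrow> (\<forall>i\<in>J. x i \<le> y i) \<Longrightarrow>
     (\<forall>i\<in>J. \<forall>j\<in>J. i \<noteq> j \<longrightarrow> y i \<le> x j \<or> y j \<le> x i) \<Longrightarrow> (\<Sum>i\<in>J. y i - x i) < \<delta> \<Longrightarrow>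
     (\<Sum>i\<in>J. P (y i) - P (x i)) \<le> \<epsilon>" by (elim exE conjE) (rule that, auto)
    show ?thesis
    proof (intro exI conjI allI impI)
      fix s t assume "s \<le> t" "t - s < \<delta>"
      \<comment> \<open>The index set \<open>{{}}\<close> has one element, so the family is the
        single interval from \<open>s\<close> to \<open>t\<close>.\<close>
      then show "P t - P s \<le> \<epsilon>" using \<delta>[of "{{}}" "\<lambda>_. s" "\<lambda>_. t"] by simp
    qed fact
  qed
  have cont: "continuous_on UNIV P"
    unfolding continuous_on_iff
  proof (intro ballI allI impI)
    fix x \<epsilon> :: real assume "0 < \<epsilon>"
    then obtain \<delta> where "0 < \<delta>" and \<delta>: "\<And>s t. s \<le> t \<Longrightarrow> t - s < \<delta> \<Longrightarrow> P t - P s \<le> \<epsilon> / 2"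
      using osc[of "\<epsilon> / 2"] by auto
    have "dist (P x') (P x) < \<epsilon>" if "dist x' x < \<delta>" for x'
      using \<delta>[of x x'] \<delta>[of x' x] mono[of x x'] mono[of x' x] that \<open>0 < \<epsilon>\<close>
      by (cases "x \<le> x'") (auto simp: dist_real_def)
    with \<open>0 < \<delta>\<close> show "\<exists>d>0. \<forall>x'\<in>UNIV. dist x' x < d \<longrightarrow> dist (P x') (P x) < \<epsilon>" by blast
  qed
  define M where "M = interval_measure P"
  have rc: "continuous (at_right a) P" for a
    using cont by (auto simp: continuous_on_eq_continuous_within intro: continuous_within_subset)
  have Ioc: "emeasure M {a<..b} = ennreal (P b - P a)" if "a \<le> b" for a b
    unfolding M_def using that mono rc by (rule emeasure_interval_measure_Ioc)
  have [simp, measurable_cong]: "sets M = sets borel" by (simp add: M_def)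
  \<comment> \<open>Boundedness of \<open>N\<close> allows a bounded open cover, whose components
    are intervals with finite endpoints. General null sets are then exhausted by balls.\<close>
  have null: "N \<in> null_sets M" if N: "N \<in> null_sets lborel" "bounded N" for N
  proof -
    have [measurable]: "N \<in> sets borel" using N(1) by auto
    have "emeasure M N \<le> ennreal \<epsilon>" if "0 < \<epsilon>" for \<epsilon>
    proof -
      from ac[unfolded abs_cont_families_def, THEN spec, THEN mp, OF that] obtain \<delta> where "0 < \<delta>" and \<delta>: "\<And>(J :: real set set) x y. finite J \<Longrightarrow> (\<forall>i\<in>J. x i \<le> y i) \<Longrightarrow>
       (\<forall>i\<in>J. \<forall>j\<in>J. i \<noteq> j \<longrightarrow> y i \<le> x j \<or> y j \<le> x i) \<Longrightarrow> (\<Sum>i\<in>J. y i - x i) < \<delta> \<Longrightarrow>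
       (\<Sum>i\<in>J. P (y i) - P (x i)) \<le> \<epsilon>" by (elim exE conjE) (rule that, auto)
      obtain V where V: "open V" "N \<subseteq> V" "emeasure lborel (V - N) < \<delta>"
        using outer_regular_lborel[of N \<delta>] \<open>0 < \<delta>\<close> by auto
      obtain k where k: "N \<subseteq> ball 0 k" using bounded_subset_ballD[OF N(2), of 0] by blast
      define U where "U = V \<inter> ball 0 k"
      have U: "open U" "N \<subseteq> U" "bounded U" using V k by (auto simp: U_def bounded_Int)
      have "emeasure lborel U \<le> emeasure lborel ((V - N) \<union> N)"
        using V by (intro emeasure_mono) (auto simp: U_def)
      also have "\<dots> = emeasure lborel (V - N)"
        using V N by (intro emeasure_Un_null_set) auto
      finally have Ud: "emeasure lborel U < \<delta>" using V by simp
      have comp: "open C" "{Inf C<..<Sup C} = C" "Inf C < Sup C" if "C \<in> components U" for C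
      proof -
        show op: "open C" using that U(1) by (rule open_components[rotated])
        have "bounded C" using U(3) in_components_subset[OF that] by (rule bounded_subset)
        then show "{Inf C<..<Sup C} = C" "Inf C < Sup C"
          using open_connected_bounded_real[OF op in_components_connected[OF that] _ in_components_nonempty[OF that]]
          by (simp_all only:)
      qed
      have sub: "C \<subseteq> {Inf C<..Sup C}" if "C \<in> components U" for C
        using greaterThanLessThan_subseteq_greaterThanAtMost_iff[of "Inf C" "Sup C" "Inf C" "Sup C"]
        unfolding comp(2)[OF that] by simp
      have Mcomp: "emeasure M C \<le> ennreal (P (Sup C) - P (Inf C))" if "C \<in> components U" for C
      proof -
        have "emeasure M C \<le> emeasure M {Inf C<..Sup C}"
          using sub[OF that] by (intro emeasure_mono) auto
        also have "\<dots> = ennreal (P (Sup C) - P (Inf C))" using comp(3)[OF that] by (intro Ioc) simp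
        finally show ?thesis .
      qed
      \<comment> \<open>Absolute continuity speaks of finite families only; the countably many
        components are reached through a bound common to all finite subfamilies.\<close>
      have fin: "measure M (\<Union>C\<in>F. C) \<le> \<epsilon>" if F: "F \<subseteq> components U" "finite F" for F
      proof -
        have "(\<Sum>C\<in>F. ennreal (Sup C - Inf C)) = (\<Sum>C\<in>F. emeasure lborel C)"
        proof (rule sum.cong[OF refl])
          fix C assume "C \<in> F"
          with F have "C \<in> components U" by blast
          from comp[OF this] show "ennreal (Sup C - Inf C) = emeasure lborel C"
            by (metis emeasure_lborel_Ioo less_imp_le)
        qed
        also have "\<dots> = emeasure lborel (\<Union>C\<in>F. C)"
        proof (rule sum_emeasure[OF _ _ F(2)])
          show "(\<lambda>C. C) ` F \<subseteq> sets lborel" using F comp(1) by (auto intro!: borel_open)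
          show "disjoint_family_on (\<lambda>C. C) F"
            using F components_nonoverlap by (fastforce simp: disjoint_family_on_def)
        qed
        also have "\<dots> \<le> emeasure lborel U"
          using F in_components_subset U by (intro emeasure_mono) (auto intro!: borel_open)
        finally have "ennreal (\<Sum>C\<in>F. Sup C - Inf C) < ennreal \<delta>"
          using Ud F comp(3) by (subst sum_ennreal[symmetric]) (auto intro: less_imp_le)
        moreover have "0 \<le> (\<Sum>C\<in>F. Sup C - Inf C)"
          using F comp(3) by (intro sum_nonneg) (auto intro: less_imp_le)
        ultimately have small: "(\<Sum>C\<in>F. Sup C - Inf C) < \<delta>"
          by (simp only: ennreal_less_iff)
        have ord: "Sup C \<le> Inf D \<or> Sup D \<le> Inf C" if "C \<in> F" "D \<in> F" "C \<noteq> D" for C D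
        proof (rule ccontr)
          assume "\<not> ?thesis"
          then have "max (Inf C) (Inf D) < min (Sup C) (Sup D)"
            using comp(3)[of C] comp(3)[of D] that F by auto
          then obtain z where "max (Inf C) (Inf D) < z" "z < min (Sup C) (Sup D)" using dense by blast
          then have "z \<in> {Inf C<..<Sup C} \<inter> {Inf D<..<Sup D}" by auto
          moreover have "{Inf C<..<Sup C} \<inter> {Inf D<..<Sup D} = {}"
          proof -
            have CD: "C \<in> components U" "D \<in> components U" using that F by auto
            with that(3) have "C \<inter> D = {}" using components_nonoverlap by blast
            then show ?thesis unfolding comp(2)[OF CD(1)] comp(2)[OF CD(2)] .
          qed
          ultimately show False by blast
        qed
        have "emeasure M (\<Union>C\<in>F. C) \<le> (\<Sum>C\<in>F. emeasure M C)"
          using F comp(1) by (intro emeasure_subadditive_finite) (auto intro!: borel_open)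
        also have "\<dots> \<le> (\<Sum>C\<in>F. ennreal (P (Sup C) - P (Inf C)))"
          using F Mcomp by (intro sum_mono) auto
        also have "\<dots> = ennreal (\<Sum>C\<in>F. P (Sup C) - P (Inf C))"
          using F comp(3) mono by (intro sum_ennreal) (auto simp: less_imp_le)
        also have "\<dots> \<le> ennreal \<epsilon>"
          using F comp(3) ord small by (intro ennreal_leI \<delta>) (auto simp: less_imp_le)
        finally show ?thesis using \<open>0 < \<epsilon>\<close> by (simp add: measure_def enn2real_leI)
      qed
      have cnt: "countable (components U)"
        using comp(1) pairwise_disjoint_components[of U]
        by (intro countable_disjoint_open_subsets) (auto simp: disjnt_def pairwise_def)
      have fm: "C \<in> fmeasurable M" if "C \<in> components U" for C
        using comp(1)[OF that] Mcomp[OF that] by (intro fmeasurableI) (auto simp: le_less_trans)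
      have "measure M (\<Union>C\<in>components U. C) \<le> \<epsilon>" "(\<Union>C\<in>components U. C) \<in> fmeasurable M"
        using measure_UN_bound[OF cnt fm fin] fmeasurable_UN_bound[OF cnt fm fin] by auto
      then have "emeasure M U \<le> ennreal \<epsilon>"
        by (simp add: emeasure_eq_measure2 ennreal_leI)
      moreover have "emeasure M N \<le> emeasure M U" using U by (intro emeasure_mono) auto
      ultimately show ?thesis by simp
    qed
    then have "emeasure M N \<le> 0 + ennreal \<epsilon>" if "0 < \<epsilon>" for \<epsilon> using that by simp
    then have "emeasure M N \<le> 0" by (rule ennreal_le_epsilon)
    then show ?thesis by (intro null_setsI) auto
  qed
  have "absolutely_continuous lborel M"
    unfolding absolutely_continuous_def
  proof
    fix N :: "real set" assume N: "N \<in> null_sets lborel"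
    have "(\<Union>k. N \<inter> ball 0 (real k)) \<in> null_sets M"
    proof (rule null_sets_UN)
      fix k show "N \<inter> ball 0 (real k) \<in> null_sets M"
      proof (rule null)
        show "N \<inter> ball 0 (real k) \<in> null_sets lborel" using N by (rule null_set_Int2) simp
      qed (simp add: bounded_Int)
    qed
    moreover have "(\<Union>k. N \<inter> ball 0 (real k)) = N" using reals_Archimedean2 by auto
    ultimately show "N \<in> null_sets M" by simp
  qed
  then obtain f where f[measurable]: "f \<in> borel_measurable lborel" and fM: "density lborel f = M"
    using sigma_finite_measure.Radon_Nikodym[OF lborel.sigma_finite_measure_axioms, of M] by auto
  have nnf: "(\<integral>\<^sup>+x. f x * indicator {a<..b} x \<partial>lborel) = ennreal (P b - P a)" if "a \<le> b" for a b
    using Ioc[OF that] unfolding fM[symmetric] by (subst (asm) emeasure_density) auto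
  \<comment> \<open>Finite integrals over \<open>{- k<..k}\<close> rule out the value infinity
    almost everywhere, which makes the real-valued version \<open>enn2real (f x)\<close> equivalent
    to \<open>f\<close>.\<close>
  have "AE x in lborel. f x \<noteq> \<infinity>"
  proof -
    have "AE x in lborel. f x * indicator {- real k<..real k} x \<noteq> \<infinity>" for k
      by (rule nn_integral_PInf_AE) (auto simp: nnf)
    then have "AE x in lborel. \<forall>k. f x * indicator {- real k<..real k} x \<noteq> \<infinity>"
      by (intro AE_all_countable[THEN iffD2] allI)
    then show ?thesis
    proof eventually_elim
      case (elim x)
      obtain k where "\<bar>x\<bar> < real k" using reals_Archimedean2 by blast
      then have "x \<in> {- real k<..real k}" by auto
      with elim[rule_format, of k] show ?case by simp
    qed
  qed
  then have gf: "AE x in lborel. ennreal (enn2real (f x)) = f x"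
    by eventually_elim (simp add: less_top)
  have g: "(\<integral>\<^sup>+x. ennreal (indicator {a<..b} x * enn2real (f x)) \<partial>lborel) = ennreal (P b - P a)" if "a \<le> b" for a b
    unfolding nnf[OF that, symmetric]
    by (rule nn_integral_cong_AE) (use gf in \<open>eventually_elim, auto simp: indicator_def\<close>)
  show thesis
  proof (rule that[of "\<lambda>x. enn2real (f x)"])
    fix a b :: real assume "a \<le> b"
    have "has_bochner_integral lborel (\<lambda>x. indicator {a<..b} x * enn2real (f x)) (P b - P a)"
      using g[OF \<open>a \<le> b\<close>] mono[OF \<open>a \<le> b\<close>] by (intro has_bochner_integral_nn_integral) auto
    then show "set_integrable lborel {a<..b} (\<lambda>x. enn2real (f x))"
      "(LINT x:{a<..b}|lborel. enn2real (f x)) = P b - P a"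
      by (auto simp: set_integrable_def set_lebesgue_integral_def has_bochner_integral_iff)
  qed auto
qed

text \<open>\<open>P\<close> and \<open>Q\<close> belong to \<open>u\<close> and \<open>- u\<close>;
  in the limit the discrete Jordan decomposition gives \<open>P t - Q t = u t - u 0\<close> on
  \<open>[0, T]\<close>. Their densities are integrable over bounded intervals, so the difference is
  cut off to \<open>{0<..T}\<close>, which also supplies the support condition used for
  convolutions.\<close>

lemma abs_cont_on_density:
  assumes ac: "abs_cont_on 0 T u" and "0 < T"
  obtains g :: "real \<Rightarrow> real" where "g \<in> borel_measurable borel" "integrable lborel g"
    "\<And>x. x \<le> 0 \<Longrightarrow> g x = 0"
    "\<And>t. 0 \<le> t \<Longrightarrow> t \<le> T \<Longrightarrow> u t = u 0 + (LINT x:{0<..t}|lborel. g x)"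
proof -
  have ac': "abs_cont_on 0 T (\<lambda>x. - u x)"
    using ac unfolding abs_cont_on_def minus_diff_minus abs_minus_cancel .
  obtain P where P: "\<And>t. (\<lambda>n. dyadic_var T (clamp_ext T u) n t) \<longlonglongrightarrow> P t" "mono P"
    "abs_cont_families TYPE(real set) P" using positive_variation[OF ac \<open>0 < T\<close>] by blast
  obtain Q where Q: "\<And>t. (\<lambda>n. dyadic_var T (clamp_ext T (\<lambda>x. - u x)) n t) \<longlonglongrightarrow> Q t" "mono Q"
    "abs_cont_families TYPE(real set) Q" using positive_variation[OF ac' \<open>0 < T\<close>] by blast
  have PQ: "P t - Q t = clamp_ext T u (min t T) - clamp_ext T u (min t 0)" for t
  proof (rule LIMSEQ_unique)
    show "(\<lambda>n. dyadic_var T (clamp_ext T u) n t - dyadic_var T (clamp_ext T (\<lambda>x. - u x)) n t) \<longlonglongrightarrow> P t - Q t"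
      by (intro tendsto_diff P Q)
    have "clamp_ext T (\<lambda>x. - u x) = (\<lambda>x. - clamp_ext T u x)" by (auto simp: clamp_ext_def)
    then show "(\<lambda>n. dyadic_var T (clamp_ext T u) n t - dyadic_var T (clamp_ext T (\<lambda>x. - u x)) n t)
       \<longlonglongrightarrow> clamp_ext T u (min t T) - clamp_ext T u (min t 0)"
      by (simp add: dyadic_var_diff_uminus)
  qed
  obtain p where p: "p \<in> borel_measurable borel" "\<And>a b. a \<le> b \<Longrightarrow> set_integrable lborel {a<..b} p"
    "\<And>a b. a \<le> b \<Longrightarrow> (LINT x:{a<..b}|lborel. p x) = P b - P a"
    using mono_abs_cont_density[OF P(2,3)] by metis
  obtain q where q: "q \<in> borel_measurable borel" "\<And>a b. a \<le> b \<Longrightarrow> set_integrable lborel {a<..b} q"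
    "\<And>a b. a \<le> b \<Longrightarrow> (LINT x:{a<..b}|lborel. q x) = Q b - Q a"
    using mono_abs_cont_density[OF Q(2,3)] by metis
  note [measurable] = p(1) q(1)
  define g where "g x = indicator {0<..T} x * (p x - q x)" for x
  show thesis
  proof (rule that[of g])
    show "g \<in> borel_measurable borel" unfolding g_def by measurable
    show "integrable lborel g"
      using set_integral_diff(1)[OF p(2) q(2), of 0 T] \<open>0 < T\<close> by (simp add: set_integrable_def g_def[abs_def])
    show "g x = 0" if "x \<le> 0" for x using that by (simp add: g_def)
    fix t assume t: "0 \<le> t" "t \<le> T"
    have "(LINT x:{0<..t}|lborel. g x) = (LINT x:{0<..t}|lborel. p x - q x)"
      unfolding set_lebesgue_integral_def
      by (rule Bochner_Integration.integral_cong) (use t in \<open>auto simp: g_def indicator_def\<close>)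
    also have "\<dots> = (P t - P 0) - (Q t - Q 0)"
      using t by (subst set_integral_diff(2)) (auto simp: p q)
    also have "\<dots> = u t - u 0"
      using PQ[of t] PQ[of 0] t by (simp add: clamp_ext_def)
    finally show "u t = u 0 + (LINT x:{0<..t}|lborel. g x)" by simp
  qed
qed

section \<open>Uniqueness of the Laplace transform\<close>

lemma AE_zero_if_initial_integrals_zero:
  fixes w :: "real \<Rightarrow> real"
  assumes int: "integrable lborel w"
    and zero: "\<And>t. 0 < t \<Longrightarrow> (LINT x:{0..t}|lborel. w x) = 0"
  shows "AE x in lborel. 0 < x \<longrightarrow> w x = 0"
proof -
  have sint: "set_integrable lborel {0..t} w" for t :: real
    unfolding set_integrable_def by (intro integrable_mult_indicator int) auto
  have H0: "integral {0..t} w = 0" for t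
    using set_borel_integral_eq_integral(2)[OF sint[of t]] zero[of t]
    by (cases t "0::real" rule: linorder_cases) simp_all
  have "AE x in lebesgue. 0 < x \<longrightarrow> x < real n \<longrightarrow> w x = 0" for n
    using lebesgue_differentiation[OF set_borel_integral_eq_integral(1)[OF sint[of "real n"]]]
    by eventually_elim (auto simp: H0 dest: DERIV_unique[OF DERIV_const])
  then have "AE x in lebesgue. \<forall>n. 0 < x \<longrightarrow> x < real n \<longrightarrow> w x = 0"
    by (intro AE_all_countable[THEN iffD2] allI)
  then have "AE x in lebesgue. 0 < x \<longrightarrow> w x = 0"
    by eventually_elim (use reals_Archimedean2 in blast)
  then show ?thesis by (simp add: AE_completion_iff)
qed

text \<open>
  With \<open>x = exp (- t)\<close> this is the determinacy of the moment problem on \<open>[0, 1]\<close>, which follows from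
  Bernstein's form of the Weierstrass approximation theorem.
\<close>

lemma exp_moments_zero_imp_AE_zero:
  fixes w :: "real \<Rightarrow> real"
  assumes int: "integrable lborel w"
    and supp: "\<And>t. t \<le> 0 \<Longrightarrow> w t = 0"
    and mom: "\<And>n::nat. (LINT t|lborel. exp (- (real n * t)) * w t) = 0"
  shows "AE t in lborel. w t = 0"
proof -
  have [measurable]: "w \<in> borel_measurable borel" using borel_measurable_integrable[OF int] by simp
  \<comment> \<open>A bound on the open unit interval is enough: \<open>exp (- t)\<close> lies there
    for \<open>t > 0\<close>, and \<open>w\<close> vanishes elsewhere.\<close>
  have dom: "integrable lborel (\<lambda>t. \<phi> (exp (- t)) * w t)"
    if [measurable]: "\<phi> \<in> borel_measurable borel" and B: "\<And>x. 0 < x \<Longrightarrow> x < 1 \<Longrightarrow> \<bar>\<phi> x\<bar> \<le> B" for \<phi> :: "real \<Rightarrow> real" and B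
  proof (rule Bochner_Integration.integrable_bound[of _ "\<lambda>t. B * w t"])
    show "AE t in lborel. norm (\<phi> (exp (- t)) * w t) \<le> norm (B * w t)"
    proof (rule AE_I2)
      fix t show "norm (\<phi> (exp (- t)) * w t) \<le> norm (B * w t)"
      proof (cases "t \<le> 0")
        case False
        then have "\<bar>\<phi> (exp (- t))\<bar> \<le> \<bar>B\<bar>" using B[of "exp (- t)"] by (simp add: order_trans[OF _ abs_ge_self])
        then show ?thesis by (simp add: abs_mult mult_right_mono)
      qed (simp add: supp)
    qed
  qed (use int in simp_all)
  \<comment> \<open>These are the building blocks \<open>x^i (1 - x)^j\<close> of Bernstein
    polynomials. Expanding one factor \<open>1 - x\<close> lowers \<open>j\<close> but raises
    \<open>i\<close> in one term, so the induction keeps \<open>i\<close> arbitrary.\<close>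
  have bern: "(LINT t|lborel. exp (- t) ^ i * (1 - exp (- t)) ^ j * w t) = 0" for i j
  proof (induction j arbitrary: i)
    case 0
    show ?case using mom[of i] by (simp add: exp_of_nat_mult[symmetric])
  next
    case (Suc j)
    have I: "integrable lborel (\<lambda>t. exp (- t) ^ i * (1 - exp (- t)) ^ j * w t)" for i
      using dom[of "\<lambda>x. x ^ i * (1 - x) ^ j" 1]
      by (simp add: abs_mult power_abs mult_le_one power_le_one)
    have "(LINT t|lborel. exp (- t) ^ i * (1 - exp (- t)) ^ Suc j * w t)
      = (LINT t|lborel. exp (- t) ^ i * (1 - exp (- t)) ^ j * w t - exp (- t) ^ Suc i * (1 - exp (- t)) ^ j * w t)"
      by (rule Bochner_Integration.integral_cong) (simp_all add: algebra_simps)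
    also have "\<dots> = 0"
      using Bochner_Integration.integral_diff[OF I[of i] I[of "Suc i"]] Suc.IH[of i] Suc.IH[of "Suc i"] by simp
    finally show ?case .
  qed
  have cont: "(LINT t|lborel. \<phi> (exp (- t)) * w t) = 0" if \<phi>: "continuous_on UNIV \<phi>" for \<phi> :: "real \<Rightarrow> real"
  proof -
    have [measurable]: "\<phi> \<in> borel_measurable borel" using \<phi> by (rule borel_measurable_continuous_onI)
    let ?L = "LINT t|lborel. \<phi> (exp (- t)) * w t" and ?W = "LINT t|lborel. \<bar>w t\<bar>"
    have "\<bar>?L\<bar> \<le> e * ?W" if "0 < e" for e
    proof -
      have c01: "continuous_on {0..1} \<phi>" using \<phi> continuous_on_subset by blast
      from Bernstein_Weierstrass[OF this \<open>0 < e\<close>] obtain N where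
        N: "\<And>x. x \<in> {0..1} \<Longrightarrow> \<bar>\<phi> x - (\<Sum>k\<le>N. \<phi>(k/N) * Bernstein N k x)\<bar> < e" by blast
      define B where "B x = (\<Sum>k\<le>N. \<phi>(k/N) * Bernstein N k x)" for x
      have [measurable]: "B \<in> borel_measurable borel" unfolding B_def Bernstein_def by measurable
      have Bint: "integrable lborel (\<lambda>t. B (exp (- t)) * w t)" and B0: "(LINT t|lborel. B (exp (- t)) * w t) = 0"
      proof -
        have I: "integrable lborel (\<lambda>t. exp (- t) ^ i * (1 - exp (- t)) ^ j * w t)" for i j
          using dom[of "\<lambda>x. x ^ i * (1 - x) ^ j" 1]
          by (simp add: abs_mult power_abs mult_le_one power_le_one)
        have *: "B (exp (- t)) * w t = (\<Sum>k\<le>N. \<phi>(k/N) * real (N choose k) * (exp (- t) ^ k * (1 - exp (- t)) ^ (N - k) * w t))" for t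
          unfolding B_def Bernstein_def sum_distrib_right by (simp add: mult.assoc)
        show "integrable lborel (\<lambda>t. B (exp (- t)) * w t)"
          unfolding * by (intro Bochner_Integration.integrable_sum integrable_mult_right I)
        show "(LINT t|lborel. B (exp (- t)) * w t) = 0"
          unfolding * by (subst Bochner_Integration.integral_sum) (simp_all add: I bern del: mult_eq_0_iff)
      qed
      have Dint: "integrable lborel (\<lambda>t. (\<phi> (exp (- t)) - B (exp (- t))) * w t)"
      proof (rule dom[of "\<lambda>x. \<phi> x - B x" e])
        show "\<bar>\<phi> x - B x\<bar> \<le> e" if "0 < x" "x < 1" for x
          using N[of x] that by (simp add: B_def)
      qed measurable
      have "\<phi> (exp (- t)) * w t = (\<phi> (exp (- t)) - B (exp (- t))) * w t + B (exp (- t)) * w t" for t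
        by (simp add: algebra_simps)
      then have "?L = (LINT t|lborel. (\<phi> (exp (- t)) - B (exp (- t))) * w t) + (LINT t|lborel. B (exp (- t)) * w t)"
        using Bochner_Integration.integral_add[OF Dint Bint] by simp
      then have "\<bar>?L\<bar> \<le> (LINT t|lborel. \<bar>(\<phi> (exp (- t)) - B (exp (- t))) * w t\<bar>)"
        using integral_abs_bound[of lborel "\<lambda>t. (\<phi> (exp (- t)) - B (exp (- t))) * w t"] by (simp add: B0)
      also have "\<dots> \<le> (LINT t|lborel. e * \<bar>w t\<bar>)"
      proof (rule integral_mono)
        fix t show "\<bar>(\<phi> (exp (- t)) - B (exp (- t))) * w t\<bar> \<le> e * \<bar>w t\<bar>"
        proof (cases "t \<le> 0")
          case False
          then show ?thesis using N[of "exp (- t)"] by (simp add: abs_mult B_def mult_right_mono)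
        qed (simp add: supp)
      qed (use Dint int in auto)
      finally show ?thesis by simp
    qed
    from this[of "inverse (real (Suc n))" for n]
    have "\<bar>?L\<bar> \<le> inverse (real (Suc n)) * ?W" for n by simp
    moreover have "(\<lambda>n. inverse (real (Suc n)) * ?W) \<longlonglongrightarrow> 0 * ?W"
      by (intro tendsto_intros LIMSEQ_inverse_real_of_nat)
    ultimately have "\<bar>?L\<bar> \<le> 0 * ?W" by (intro LIMSEQ_le_const) auto
    then show ?thesis by simp
  qed
  have "(LINT x:{0..T}|lborel. w x) = 0" if "0 < T" for T
  proof -
    \<comment> \<open>A continuous ramp in \<open>x = exp (- t)\<close>: it equals 1 for
      \<open>x \<ge> exp (- T)\<close>, that is \<open>t \<le> T\<close>, and falls to 0 over a
      distance \<open>1 / n\<close>. On the support of \<open>w\<close> the limit is the indicator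
      of \<open>{0..T}\<close>.\<close>
    define \<phi> where "\<phi> n x = min 1 (max 0 (1 - real n * (exp (- T) - x)))" for n x
    have "(\<lambda>n. LINT t|lborel. \<phi> n (exp (- t)) * w t) \<longlonglongrightarrow> (LINT t|lborel. indicator {0..T} t * w t)"
    proof (rule integral_dominated_convergence[where w="\<lambda>t. \<bar>w t\<bar>"])
      show "AE t in lborel. (\<lambda>n. \<phi> n (exp (- t)) * w t) \<longlonglongrightarrow> indicator {0..T} t * w t"
      proof (rule AE_I2)
        fix t
        consider "t \<le> 0" | "0 < t" "t \<le> T" | "T < t" by linarith
        then show "(\<lambda>n. \<phi> n (exp (- t)) * w t) \<longlonglongrightarrow> indicator {0..T} t * w t"
        proof cases
          case 2
          then have "exp (- T) - exp (- t) \<le> 0" by simp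
          then have "real n * (exp (- T) - exp (- t)) \<le> 0" for n
            by (intro mult_nonneg_nonpos) simp_all
          moreover have "min 1 (max 0 (1 - z)) = 1" if "z \<le> 0" for z :: real
            using that by simp
          ultimately have "\<phi> n (exp (- t)) = 1" for n
            unfolding \<phi>_def by blast
          with 2 show ?thesis by simp
        next
          case 3
          obtain N where N: "1 / (exp (- T) - exp (- t)) < real N" using reals_Archimedean2 by blast
          have "\<phi> n (exp (- t)) = 0" if "n \<ge> N" for n
          proof -
            have "1 / (exp (- T) - exp (- t)) < real n" using N that by linarith
            with 3 have "1 < real n * (exp (- T) - exp (- t))" by (simp add: field_simps)
            then show ?thesis by (simp add: \<phi>_def)
          qed
          with 3 show ?thesis
            by (intro tendsto_eventually eventually_sequentiallyI[of N]) auto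
        qed (simp add: supp)
      qed
      show "AE t in lborel. norm (\<phi> n (exp (- t)) * w t) \<le> \<bar>w t\<bar>" for n
        by (intro AE_I2) (auto simp: \<phi>_def abs_mult mult_left_le_one_le)
    qed (use int in \<open>auto simp: \<phi>_def\<close>)
    moreover have "(LINT t|lborel. \<phi> n (exp (- t)) * w t) = 0" for n
      unfolding \<phi>_def by (intro cont continuous_intros)
    ultimately have "(LINT t|lborel. indicator {0..T} t * w t) = 0"
      by (simp add: LIMSEQ_const_iff)
    then show ?thesis by (simp add: set_lebesgue_integral_def)
  qed
  then have "AE t in lborel. 0 < t \<longrightarrow> w t = 0"
    by (rule AE_zero_if_initial_integrals_zero[OF int])
  then show ?thesis
    by eventually_elim (use supp in \<open>auto simp: not_less[symmetric]\<close>)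
qed

section \<open>Convolutions\<close>

text \<open>By nonnegativity of \<open>a\<close> and \<open>b\<close>, Tonelli turns the double
  integral of absolute values into the integral of \<open>c (t - r) * \<bar>g r\<bar>\<close>, which
  is finite by \<open>fin\<close>; Fubini then applies. Since \<open>c\<close> enters only under the
  integral over \<open>r\<close>, it may differ from the convolution of \<open>a\<close> and
  \<open>b\<close> on a null set, and still the conclusion concerns the individual point
  \<open>t\<close>.\<close>

lemma convolution_assoc:
  fixes a b c g :: "real \<Rightarrow> real"
  assumes [measurable]: "a \<in> borel_measurable borel" "b \<in> borel_measurable borel"
      "c \<in> borel_measurable borel" "g \<in> borel_measurable borel"
    and nn: "\<And>x. 0 \<le> a x" "\<And>x. 0 \<le> b x" "\<And>x. 0 \<le> c x"
    and c: "AE x in lborel. (\<integral>\<^sup>+s. ennreal (a (x - s) * b s) \<partial>lborel) = ennreal (c x)"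
    and fin: "integrable lborel (\<lambda>r. c (t - r) * g r)"
  shows "(LINT s|lborel. a (t - s) * (LINT r|lborel. b (s - r) * g r)) = (LINT r|lborel. c (t - r) * g r)"
    and "integrable lborel (\<lambda>s. a (t - s) * (LINT r|lborel. b (s - r) * g r))"
proof -
  let ?F = "\<lambda>s r. a (t - s) * b (s - r) * g r"
  have "AE r in lborel. (\<integral>\<^sup>+s. ennreal (a ((t + (-1) * r) - s) * b s) \<partial>lborel) = ennreal (c (t + (-1) * r))"
    by (rule AE_borel_affine[OF _ _ c]) simp_all
  then have inner: "AE r in lborel. (\<integral>\<^sup>+s. ennreal (a (t - s) * b (s - r)) \<partial>lborel) = ennreal (c (t - r))"
  proof eventually_elim
    case (elim r)
    have "(\<integral>\<^sup>+s. ennreal (a (t - s) * b (s - r)) \<partial>lborel)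
        = ennreal \<bar>1::real\<bar> * (\<integral>\<^sup>+s. ennreal (a (t - (r + 1 * s)) * b ((r + 1 * s) - r)) \<partial>lborel)"
      by (rule nn_integral_real_affine) simp_all
    then show ?case using elim by (simp add: algebra_simps)
  qed
  have "(\<integral>\<^sup>+x. ennreal (norm (case_prod ?F x)) \<partial>(lborel \<Otimes>\<^sub>M lborel))
      = (\<integral>\<^sup>+r. \<integral>\<^sup>+s. ennreal (norm (?F s r)) \<partial>lborel \<partial>lborel)"
    by (subst lborel_pair.nn_integral_snd[symmetric]) simp_all
  also have "\<dots> = (\<integral>\<^sup>+r. ennreal (norm (c (t - r) * g r)) \<partial>lborel)"
  proof (rule nn_integral_cong_AE)
    show "AE r in lborel. (\<integral>\<^sup>+s. ennreal (norm (?F s r)) \<partial>lborel) = ennreal (norm (c (t - r) * g r))"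
      using inner
    proof eventually_elim
      case (elim r)
      have "(\<integral>\<^sup>+s. ennreal (norm (?F s r)) \<partial>lborel) = (\<integral>\<^sup>+s. ennreal (a (t - s) * b (s - r)) * ennreal \<bar>g r\<bar> \<partial>lborel)"
        using nn by (intro nn_integral_cong) (simp add: abs_mult ennreal_mult'')
      also have "\<dots> = (\<integral>\<^sup>+s. ennreal (a (t - s) * b (s - r)) \<partial>lborel) * ennreal \<bar>g r\<bar>"
        by (rule nn_integral_multc) simp
      also have "\<dots> = ennreal (norm (c (t - r) * g r))"
        unfolding elim using nn by (simp add: abs_mult ennreal_mult'')
      finally show ?case .
    qed
  qed
  also have "\<dots> < \<infinity>" using fin by (simp add: integrable_iff_bounded)
  finally have int: "integrable (lborel \<Otimes>\<^sub>M lborel) (case_prod ?F)"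
    by (intro integrableI_bounded) simp_all
  have eq: "(LINT r|lborel. ?F s r) = a (t - s) * (LINT r|lborel. b (s - r) * g r)" for s
    by (simp add: mult.assoc)
  show "integrable lborel (\<lambda>s. a (t - s) * (LINT r|lborel. b (s - r) * g r))"
    using lborel_pair.integrable_fst'[OF int] by (simp add: eq)
  have "(LINT s|lborel. a (t - s) * (LINT r|lborel. b (s - r) * g r)) = (LINT r|lborel. LINT s|lborel. ?F s r)"
    using lborel_pair.Fubini_integral[OF int] by (simp add: eq)
  also have "\<dots> = (LINT r|lborel. c (t - r) * g r)"
  proof (rule integral_cong_AE)
    show "AE r in lborel. (LINT s|lborel. ?F s r) = c (t - r) * g r"
      using inner
    proof eventually_elim
      case (elim r)
      have "(LINT s|lborel. a (t - s) * b (s - r)) = c (t - r)"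
        using nn by (subst integral_eq_nn_integral) (auto simp: elim)
      then show ?case by simp
    qed
  qed simp_all
  finally show "(LINT s|lborel. a (t - s) * (LINT r|lborel. b (s - r) * g r)) = (LINT r|lborel. c (t - r) * g r)" .
qed

lemma nn_convolution_commute:
  fixes a b :: "real \<Rightarrow> real"
  assumes [measurable]: "a \<in> borel_measurable borel" "b \<in> borel_measurable borel"
  shows "(\<integral>\<^sup>+s. ennreal (a (x - s) * b s) \<partial>lborel) = (\<integral>\<^sup>+s. ennreal (b (x - s) * a s) \<partial>lborel)"
  using nn_integral_real_affine[of "\<lambda>s. ennreal (a (x - s) * b s)" "-1" x] by (simp add: mult.commute)

text \<open>The convolution theorem, stated in the extended nonnegative reals so that Tonelli
  suffices and finiteness can be read off afterwards.\<close>

lemma nn_convolution_exp: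
  fixes a b :: "real \<Rightarrow> real"
  assumes [measurable]: "a \<in> borel_measurable borel" "b \<in> borel_measurable borel"
    and nn: "\<And>x. 0 \<le> a x" "\<And>x. 0 \<le> b x"
  shows "(\<integral>\<^sup>+x. ennreal (exp (- p * x)) * (\<integral>\<^sup>+s. ennreal (a (x - s) * b s) \<partial>lborel) \<partial>lborel)
     = (\<integral>\<^sup>+x. ennreal (exp (- p * x) * a x) \<partial>lborel) * (\<integral>\<^sup>+x. ennreal (exp (- p * x) * b x) \<partial>lborel)"
proof -
  have "(\<integral>\<^sup>+x. ennreal (exp (- p * x)) * (\<integral>\<^sup>+s. ennreal (a (x - s) * b s) \<partial>lborel) \<partial>lborel)
      = (\<integral>\<^sup>+x. \<integral>\<^sup>+s. ennreal (exp (- p * (x - s)) * a (x - s)) * ennreal (exp (- p * s) * b s) \<partial>lborel \<partial>lborel)"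
  proof (rule nn_integral_cong)
    fix x :: real
    have "(\<integral>\<^sup>+s. ennreal (exp (- p * (x - s)) * a (x - s)) * ennreal (exp (- p * s) * b s) \<partial>lborel)
        = (\<integral>\<^sup>+s. ennreal (exp (- p * x)) * ennreal (a (x - s) * b s) \<partial>lborel)"
    proof (rule nn_integral_cong)
      fix s
      have "exp (- p * (x - s)) * a (x - s) * (exp (- p * s) * b s) = exp (- p * x) * (a (x - s) * b s)"
      proof -
        have "exp (- p * (x - s)) * exp (- p * s) = exp (- p * x)"
          by (simp add: exp_add[symmetric] algebra_simps)
        then show ?thesis by (metis (no_types, lifting) mult.assoc mult.left_commute)
      qed
      then show "ennreal (exp (- p * (x - s)) * a (x - s)) * ennreal (exp (- p * s) * b s) = ennreal (exp (- p * x)) * ennreal (a (x - s) * b s)"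
        using nn by (simp add: ennreal_mult[symmetric])
    qed
    then show "ennreal (exp (- p * x)) * (\<integral>\<^sup>+s. ennreal (a (x - s) * b s) \<partial>lborel)
       = (\<integral>\<^sup>+s. ennreal (exp (- p * (x - s)) * a (x - s)) * ennreal (exp (- p * s) * b s) \<partial>lborel)"
      by (simp add: nn_integral_cmult)
  qed
  also have "\<dots> = (\<integral>\<^sup>+s. \<integral>\<^sup>+x. ennreal (exp (- p * (x - s)) * a (x - s)) * ennreal (exp (- p * s) * b s) \<partial>lborel \<partial>lborel)"
    by (rule lborel_pair.Fubini') simp
  also have "\<dots> = (\<integral>\<^sup>+s. (\<integral>\<^sup>+x. ennreal (exp (- p * x) * a x) \<partial>lborel) * ennreal (exp (- p * s) * b s) \<partial>lborel)"
  proof (rule nn_integral_cong)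
    fix s :: real
    have "(\<integral>\<^sup>+x. ennreal (exp (- p * (x - s)) * a (x - s)) \<partial>lborel) = (\<integral>\<^sup>+x. ennreal (exp (- p * x) * a x) \<partial>lborel)"
      using nn_integral_real_affine[of "\<lambda>x. ennreal (exp (- p * (x - s)) * a (x - s))" 1 s] by simp
    then show "(\<integral>\<^sup>+x. ennreal (exp (- p * (x - s)) * a (x - s)) * ennreal (exp (- p * s) * b s) \<partial>lborel)
       = (\<integral>\<^sup>+x. ennreal (exp (- p * x) * a x) \<partial>lborel) * ennreal (exp (- p * s) * b s)"
      by (simp add: nn_integral_multc)
  qed
  also have "\<dots> = (\<integral>\<^sup>+x. ennreal (exp (- p * x) * a x) \<partial>lborel) * (\<integral>\<^sup>+x. ennreal (exp (- p * x) * b x) \<partial>lborel)"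
    by (rule nn_integral_cmult) simp
  finally show ?thesis .
qed

section \<open>Borel versions and Laplace integrals\<close>

text \<open>Completeness makes \<open>f\<close> measurable whatever it does on the null set where it
  differs from \<open>g\<close>. The integrands of \<open>conv0\<close> and \<open>Ik\<close> are
  replaced by Borel functions in this way, including those built from \<open>Dk k u\<close>.\<close>

lemma AE_eq_borel_imp_lebesgue:
  fixes f g :: "real \<Rightarrow> real"
  assumes [measurable]: "g \<in> borel_measurable borel" and eq: "AE x in lborel. f x = g x"
  shows "f \<in> borel_measurable lebesgue" and "integral\<^sup>L lebesgue f = integral\<^sup>L lborel g"
proof -
  from AE_E3[OF eq] obtain N where "N \<in> null_sets lborel" "\<And>x. x \<in> space lborel - N \<Longrightarrow> f x = g x"
    by blast
  then have N: "N \<in> null_sets lebesgue" "{x. f x \<noteq> g x} \<subseteq> N"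
    by (auto intro: null_sets_completionI)
  have g: "g \<in> borel_measurable lebesgue" by (simp add: measurable_completion)
  show f: "f \<in> borel_measurable lebesgue"
  proof (rule measurableI)
    fix A :: "real set" assume "A \<in> sets borel"
    then have "g -` A \<in> sets lebesgue" using measurable_sets[OF g] by simp
    moreover have "N \<in> sets lebesgue" using N(1) by (rule null_setsD2)
    moreover have "f -` A \<inter> N \<in> sets lebesgue"
      by (rule null_setsD2[OF null_sets_completion_subset[OF Int_lower2 N(1)]])
    ultimately have "(g -` A - N) \<union> (f -` A \<inter> N) \<in> sets lebesgue" by (intro sets.Un sets.Diff)
    also have "(g -` A - N) \<union> (f -` A \<inter> N) = f -` A" using N(2) by auto
    finally show "f -` A \<inter> space lebesgue \<in> sets lebesgue" by simp
  qed simp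
  have "integral\<^sup>L lebesgue f = integral\<^sup>L lebesgue g"
    using eq by (intro integral_cong_AE f g) (simp add: AE_completion_iff)
  also have "\<dots> = integral\<^sup>L lborel g" by (rule integral_completion) simp
  finally show "integral\<^sup>L lebesgue f = integral\<^sup>L lborel g" .
qed

lemma ex_borel_version:
  fixes f :: "real \<Rightarrow> real"
  assumes "set_borel_measurable lebesgue {0<..} f"
  obtains g where "g \<in> borel_measurable borel" "\<And>x. x \<le> 0 \<Longrightarrow> g x = 0"
    "AE x in lborel. 0 < x \<longrightarrow> f x = g x"
proof -
  have "(\<lambda>x. indicator {0<..} x * f x) \<in> borel_measurable lebesgue"
    using assms by (simp add: set_borel_measurable_def)
  then obtain g' where [measurable]: "g' \<in> borel_measurable lborel"
    and g': "AE x in lborel. indicator {0<..} x * f x = g' x"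
    using completion_ex_borel_measurable_real by blast
  show thesis
  proof (rule that[of "\<lambda>x. indicator {0<..} x * g' x"])
    show "AE x in lborel. 0 < x \<longrightarrow> f x = indicator {0<..} x * g' x"
      using g' by eventually_elim auto
  qed auto
qed

text \<open>Measurability of \<open>k\<close> is recovered from the integrable function
  \<open>exp (- p * t) * k t\<close> by multiplying with \<open>exp (p * t)\<close>.\<close>

lemma ex_nonneg_borel_version:
  fixes k :: "real \<Rightarrow> real"
  assumes int: "set_integrable lebesgue {0<..} (\<lambda>t. exp (- p * t) * k t)"
    and nn: "\<And>t. 0 < t \<Longrightarrow> 0 \<le> k t"
  obtains g where "g \<in> borel_measurable borel" "\<And>x. x \<le> 0 \<Longrightarrow> g x = 0" "\<And>x. 0 \<le> g x"
    "AE x in lborel. 0 < x \<longrightarrow> k x = g x"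
proof -
  have "(\<lambda>t. indicator {0<..} t * (exp (- p * t) * k t)) \<in> borel_measurable lebesgue"
    using borel_measurable_integrable[OF int[unfolded set_integrable_def]] by simp
  moreover have "(\<lambda>t. exp (p * t)) \<in> borel_measurable lebesgue"
    by (rule measurable_completion) simp
  ultimately have "(\<lambda>t. exp (p * t) * (indicator {0<..} t * (exp (- p * t) * k t))) \<in> borel_measurable lebesgue"
    by (rule borel_measurable_times[rotated])
  also have "(\<lambda>t. exp (p * t) * (indicator {0<..} t * (exp (- p * t) * k t))) = (\<lambda>t. indicator {0<..} t * k t)"
    by (auto simp: exp_minus field_simps indicator_def)
  finally have "set_borel_measurable lebesgue {0<..} k" by (simp add: set_borel_measurable_def)
  from ex_borel_version[OF this] obtain g where [measurable]: "g \<in> borel_measurable borel"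
    and g: "\<And>x. x \<le> 0 \<Longrightarrow> g x = 0" "AE x in lborel. 0 < x \<longrightarrow> k x = g x" by blast
  show thesis
  proof (rule that[of "\<lambda>x. max 0 (g x)"])
    show "AE x in lborel. 0 < x \<longrightarrow> k x = max 0 (g x)"
      using g(2)
    proof eventually_elim
      case (elim x)
      then show ?case using nn[of x] by (auto simp: max_def)
    qed
  qed (use g in auto)
qed

lemma nn_integral_exp_eq_laplace:
  fixes k g :: "real \<Rightarrow> real"
  assumes int: "set_integrable lebesgue {0<..} (\<lambda>t. exp (- p * t) * k t)"
    and [measurable]: "g \<in> borel_measurable borel"
    and g: "\<And>x. x \<le> 0 \<Longrightarrow> g x = 0" "\<And>x. 0 \<le> g x" "AE x in lborel. 0 < x \<longrightarrow> k x = g x"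
  shows "(\<integral>\<^sup>+x. ennreal (exp (- p * x) * g x) \<partial>lborel) = ennreal (laplace k p)"
proof -
  let ?f = "\<lambda>t. indicator {0<..} t * (exp (- p * t) * k t)"
  have ae: "AE t in lborel. ?f t = exp (- p * t) * g t"
    using g(3) by eventually_elim (use g(1) in \<open>auto simp: indicator_def not_less\<close>)
  have "(\<integral>\<^sup>+x. ennreal (exp (- p * x) * g x) \<partial>lborel) = (\<integral>\<^sup>+x. ennreal (exp (- p * x) * g x) \<partial>lebesgue)"
    by (rule nn_integral_completion[symmetric])
  also have "\<dots> = (\<integral>\<^sup>+x. ennreal (?f x) \<partial>lebesgue)"
  proof (rule nn_integral_cong_AE)
    show "AE x in lebesgue. ennreal (exp (- p * x) * g x) = ennreal (?f x)"
      using ae unfolding AE_completion_iff by eventually_elim (simp only:)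
  qed
  also have "\<dots> = ennreal (integral\<^sup>L lebesgue ?f)"
  proof (rule nn_integral_eq_integral)
    show "integrable lebesgue ?f" using int by (simp add: set_integrable_def)
    show "AE x in lebesgue. 0 \<le> ?f x"
      using ae unfolding AE_completion_iff by eventually_elim (simp only: mult_nonneg_nonneg[OF exp_ge_zero g(2)])
  qed
  also have "integral\<^sup>L lebesgue ?f = laplace k p"
    by (simp add: laplace_def set_lebesgue_integral_def)
  finally show ?thesis .
qed

lemma nn_integral_exp_half_line:
  fixes p :: real assumes "0 < p"
  shows "(\<integral>\<^sup>+x. ennreal (exp (- p * x) * indicator {0<..} x) \<partial>lborel) = ennreal (1 / p)"
proof -
  have "((\<lambda>x. - exp (- p * x) / p) \<longlongrightarrow> - 0 / p) at_top"
    using \<open>0 < p\<close>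
    by (intro tendsto_intros filterlim_compose[OF exp_at_bot] filterlim_tendsto_neg_mult_at_bot[OF tendsto_const _ filterlim_ident])
       simp_all
  moreover have "((\<lambda>x. - exp (- p * x) / p) has_real_derivative exp (- p * x)) (at x)" for x
    using \<open>0 < p\<close> by (auto intro!: derivative_eq_intros)
  ultimately have "(\<integral>\<^sup>+x. ennreal (exp (- p * x)) * indicator {0..} x \<partial>lborel) = - 0 / p - (- exp (- p * 0) / p)"
    by (intro nn_integral_FTC_atLeast) simp_all
  moreover have "(\<integral>\<^sup>+x. ennreal (exp (- p * x)) * indicator {0..} x \<partial>lborel)
      = (\<integral>\<^sup>+x. ennreal (exp (- p * x) * indicator {0<..} x) \<partial>lborel)"
  proof (rule nn_integral_cong_AE)
    show "AE x in lborel. ennreal (exp (- p * x)) * indicator {0..} x = ennreal (exp (- p * x) * indicator {0<..} x)"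
      using AE_lborel_singleton[of "0::real"] by eventually_elim (auto simp: indicator_def)
  qed
  ultimately show ?thesis by simp
qed

text \<open>The convolution and the unit step have the same Laplace transform \<open>1 / p\<close>;
  comparing them at the positive integers is enough.\<close>

lemma convolution_eq_indicator:
  fixes a b :: "real \<Rightarrow> real"
  assumes [measurable]: "a \<in> borel_measurable borel" "b \<in> borel_measurable borel"
    and nn: "\<And>x. 0 \<le> a x" "\<And>x. 0 \<le> b x"
    and supp: "\<And>x. x \<le> 0 \<Longrightarrow> a x = 0" "\<And>x. x \<le> 0 \<Longrightarrow> b x = 0"
    and L: "\<And>p. 0 < p \<Longrightarrow> (\<integral>\<^sup>+x. ennreal (exp (- p * x) * a x) \<partial>lborel)
        * (\<integral>\<^sup>+x. ennreal (exp (- p * x) * b x) \<partial>lborel) = ennreal (1 / p)"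
  shows "AE x in lborel. (\<integral>\<^sup>+s. ennreal (a (x - s) * b s) \<partial>lborel) = ennreal (indicator {0<..} x)"
proof -
  define C where "C x = (\<integral>\<^sup>+s. ennreal (a (x - s) * b s) \<partial>lborel)" for x
  have [measurable]: "C \<in> borel_measurable borel" unfolding C_def by measurable
  have C0: "C x = 0" if "x \<le> 0" for x
  proof -
    have z: "a (x - s) * b s = 0" for s using supp(1)[of "x - s"] supp(2)[of s] that by (cases "s \<le> 0") auto
    show ?thesis unfolding C_def z by simp
  qed
  have CL: "(\<integral>\<^sup>+x. ennreal (exp (- p * x)) * C x \<partial>lborel) = ennreal (1 / p)" if "0 < p" for p
    unfolding C_def using nn_convolution_exp[OF assms(1,2) nn, of p] L[OF that] by simp
  \<comment> \<open>The convolution may be infinite at some points; finiteness of its transform at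
    \<open>p = 1\<close> confines them to a null set.\<close>
  have "AE x in lborel. ennreal (exp (- 1 * x)) * C x \<noteq> \<infinity>"
    by (rule nn_integral_PInf_AE) (use CL[of 1] in simp_all)
  then have Cfin: "AE x in lborel. ennreal (enn2real (C x)) = C x"
    by eventually_elim (auto simp: ennreal_mult_eq_top_iff less_top)
  have hb: "has_bochner_integral lborel (\<lambda>x. exp (- p * x) * enn2real (C x)) (1 / p)" if "0 < p" for p
  proof (rule has_bochner_integral_nn_integral)
    have "(\<integral>\<^sup>+x. ennreal (exp (- p * x) * enn2real (C x)) \<partial>lborel) = (\<integral>\<^sup>+x. ennreal (exp (- p * x)) * C x \<partial>lborel)"
    proof (rule nn_integral_cong_AE)
      show "AE x in lborel. ennreal (exp (- p * x) * enn2real (C x)) = ennreal (exp (- p * x)) * C x"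
        using Cfin by eventually_elim (simp add: ennreal_mult)
    qed
    then show "(\<integral>\<^sup>+x. ennreal (exp (- p * x) * enn2real (C x)) \<partial>lborel) = ennreal (1 / p)"
      by (simp only: CL[OF that])
  qed (use that in auto)
  have hi: "has_bochner_integral lborel (\<lambda>x. exp (- p * x) * indicator {0<..} x) (1 / p :: real)" if "0 < p" for p
    by (rule has_bochner_integral_nn_integral) (use that nn_integral_exp_half_line[OF that] in auto)
  \<comment> \<open>The factor \<open>exp (- x)\<close> makes the difference integrable and shifts
    the parameter: the moment of order \<open>n\<close> of \<open>w\<close> is the difference of the
    transforms at \<open>p = n + 1\<close>, so order 0 is covered.\<close>
  define w where "w x = exp (- x) * (enn2real (C x) - indicator {0<..} x)" for x :: real
  have hw: "has_bochner_integral lborel (\<lambda>x. exp (- (real n * x)) * w x) 0" for n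
  proof -
    have e: "exp (- (real n * x)) * w x
        = exp (- real (Suc n) * x) * enn2real (C x) - exp (- real (Suc n) * x) * indicator {0<..} x" for x
    proof -
      have "exp (- real (Suc n) * x) = exp (- (real n * x)) * exp (- x)"
        by (simp add: exp_add[symmetric] algebra_simps)
      then show ?thesis by (simp add: w_def algebra_simps)
    qed
    show ?thesis
      unfolding e using has_bochner_integral_diff[OF hb[of "real (Suc n)"] hi[of "real (Suc n)"]] by simp
  qed
  have "AE x in lborel. w x = 0"
  proof (rule exp_moments_zero_imp_AE_zero)
    show "integrable lborel w" using hw[of 0] by (simp add: has_bochner_integral_iff)
    show "w t = 0" if "t \<le> 0" for t using that by (simp add: w_def C0)
    show "(LINT t|lborel. exp (- (real n * t)) * w t) = 0" for n
      using hw[of n] by (simp add: has_bochner_integral_iff)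
  qed
  with Cfin show ?thesis unfolding C_def[symmetric]
    by eventually_elim (simp add: w_def)
qed

lemma conv0_eq_lborel:
  fixes k u k1 u1 :: "real \<Rightarrow> real"
  assumes [measurable]: "k1 \<in> borel_measurable borel" "u1 \<in> borel_measurable borel"
    and supp: "\<And>x. x \<le> 0 \<Longrightarrow> k1 x = 0" "\<And>x. x \<le> 0 \<Longrightarrow> u1 x = 0"
    and k: "AE x in lborel. 0 < x \<longrightarrow> k x = k1 x"
    and u: "AE x in lborel. 0 < x \<longrightarrow> x < t \<longrightarrow> u x = u1 x"
  shows "conv0 k u t = (LINT s|lborel. k1 (t - s) * u1 s)"
proof -
  have "AE x in lborel. 0 < t + (-1) * x \<longrightarrow> k1 (t + (-1) * x) = k (t + (-1) * x)"
  proof -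
    \<comment> \<open>The exceptional set need not be Borel; a Borel null set around it is what the
      reflection \<open>x \<mapsto> t - x\<close> can be applied to.\<close>
    from AE_E3[OF k] obtain N where "N \<in> null_sets lborel" "\<And>x. x \<in> space lborel - N \<Longrightarrow> 0 < x \<longrightarrow> k x = k1 x"
      by blast
    then have N: "N \<in> null_sets lborel" "{x. \<not> (0 < x \<longrightarrow> k x = k1 x)} \<subseteq> N" by auto
    have [measurable]: "N \<in> sets borel" using N(1) by auto
    have "AE x in lborel. t + (-1) * x \<notin> N"
      by (rule AE_borel_affine[of "-1" "\<lambda>x. x \<notin> N"]) (use N(1) AE_not_in in auto)
    then show ?thesis
    proof eventually_elim
      case (elim x)
      then have "\<not> \<not> (0 < t + (-1) * x \<longrightarrow> k (t + (-1) * x) = k1 (t + (-1) * x))"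
        using N(2) by blast
      then show ?case by simp
    qed
  qed
  with u AE_lborel_singleton[of 0] AE_lborel_singleton[of t]
  have "AE s in lborel. indicator {0..t} s * (k (t - s) * u s) = k1 (t - s) * u1 s"
  proof eventually_elim
    case (elim s)
    then show ?case using supp(1)[of "t - s"] supp(2)[of s]
      by (cases "0 < s"; cases "s < t") (auto simp: indicator_def)
  qed
  then have "integral\<^sup>L lebesgue (\<lambda>s. indicator {0..t} s * (k (t - s) * u s)) = (LINT s|lborel. k1 (t - s) * u1 s)"
    by (intro AE_eq_borel_imp_lebesgue) simp_all
  then show ?thesis by (simp add: conv0_def set_lebesgue_integral_def)
qed

text \<open>Integrability is given only up to points strictly below \<open>T\<close>, so Lebesgue's
  theorem is applied on \<open>{0..T'}\<close> and \<open>T'\<close> runs through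
  \<open>T - inverse (Suc n)\<close>.\<close>

lemma AE_deriv_indefinite_integral:
  fixes h :: "real \<Rightarrow> real"
  assumes [measurable]: "h \<in> borel_measurable borel" and supp: "\<And>x. x \<le> 0 \<Longrightarrow> h x = 0"
    and int: "\<And>t. 0 < t \<Longrightarrow> t < T \<Longrightarrow> integrable lborel (\<lambda>r. indicator {0<..} (t - r) * h r)"
    and K: "\<And>t. 0 < t \<Longrightarrow> t < T \<Longrightarrow> K t = (LINT r|lborel. indicator {0<..} (t - r) * h r)"
  shows "AE t in lborel. 0 < t \<longrightarrow> t < T \<longrightarrow> (K has_real_derivative h t) (at t)"
proof -
  have ae: "AE r in lborel. indicator {0<..} (t - r) * h r = indicator {0..t} r * h r" for t
    using AE_lborel_singleton[of t] by eventually_elim (use supp in \<open>auto simp: indicator_def\<close>)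
  have sint: "set_integrable lborel {0..t} h" if "0 < t" "t < T" for t
    unfolding set_integrable_def using int[OF that] ae[of t]
    by (subst (asm) integrable_cong_AE) simp_all
  have KH: "K t = integral {0..t} h" if "0 < t" "t < T" for t
  proof -
    have "K t = (LINT r:{0..t}|lborel. h r)"
      unfolding K[OF that] set_lebesgue_integral_def using ae[of t] by (intro integral_cong_AE) simp_all
    then show ?thesis using set_borel_integral_eq_integral(2)[OF sint[OF that]] by simp
  qed
  have step: "AE t in lborel. 0 < t \<longrightarrow> t < T' \<longrightarrow> (K has_real_derivative h t) (at t)" if "0 < T'" "T' < T" for T'
  proof -
    have "AE t in lebesgue. 0 < t \<longrightarrow> t < T' \<longrightarrow> ((\<lambda>t. integral {0..t} h) has_real_derivative h t) (at t)"
      by (rule lebesgue_differentiation) (rule set_borel_integral_eq_integral(1)[OF sint[OF that]])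
    then have "AE t in lborel. 0 < t \<longrightarrow> t < T' \<longrightarrow> ((\<lambda>t. integral {0..t} h) has_real_derivative h t) (at t)"
      by (simp add: AE_completion_iff)
    then show ?thesis
    proof eventually_elim
      case (elim t)
      show ?case
      proof (intro impI)
        assume t: "0 < t" "t < T'"
        show "(K has_real_derivative h t) (at t)"
        proof (rule has_field_derivative_transform_within_open)
          show "((\<lambda>t. integral {0..t} h) has_real_derivative h t) (at t)" using elim t by simp
          show "open {0<..<T'}" "t \<in> {0<..<T'}" using t by auto
          show "integral {0..x} h = K x" if "x \<in> {0<..<T'}" for x
            using KH[of x] that \<open>T' < T\<close> by simp
        qed
      qed
    qed
  qed
  have "AE t in lborel. 0 < t \<longrightarrow> t < T - inverse (real (Suc n)) \<longrightarrow> (K has_real_derivative h t) (at t)" for n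
  proof (cases "0 < T - inverse (real (Suc n))")
    case True
    then show ?thesis by (intro step) simp_all
  next
    case False
    then show ?thesis by (intro AE_I2) auto
  qed
  then have "AE t in lborel. \<forall>n. 0 < t \<longrightarrow> t < T - inverse (real (Suc n)) \<longrightarrow> (K has_real_derivative h t) (at t)"
    by (intro AE_all_countable[THEN iffD2] allI)
  then show ?thesis
  proof eventually_elim
    case (elim t)
    show ?case
    proof (intro impI)
      assume t: "0 < t" "t < T"
      then obtain n where "inverse (real (Suc n)) < T - t" using reals_Archimedean[of "T - t"] by auto
      then have "t < T - inverse (real (Suc n))" by linarith
      with elim t show "(K has_real_derivative h t) (at t)" by blast
    qed
  qed
qed

section \<open>Sonine kernels\<close>

abbreviation unit_step :: "real \<Rightarrow> real" where
  "unit_step \<equiv> indicator {0<..}"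

text \<open>A nonpositive value at one \<open>p\<close> forces \<open>k1 = 0\<close> almost
  everywhere and hence nonpositive values at all \<open>p > 0\<close>, against the blow-up at 0.
  Positivity is what allows \<open>laplace k p\<close> to be cancelled in
  \<open>1 / (p * laplace k p)\<close>, where a zero would give the default value 0.\<close>

lemma laplace_pos:
  assumes lim1: "filterlim (laplace k) at_top (at_right 0)"
    and k1[measurable]: "k1 \<in> borel_measurable borel" and nn: "\<And>x. 0 \<le> k1 x"
    and Lk: "\<And>p. 0 < p \<Longrightarrow> (\<integral>\<^sup>+x. ennreal (exp (- p * x) * k1 x) \<partial>lborel) = ennreal (laplace k p)"
    and p: "0 < p"
  shows "0 < laplace k p"
proof (rule ccontr)
  assume "\<not> 0 < laplace k p"
  then have "(\<integral>\<^sup>+x. ennreal (exp (- p * x) * k1 x) \<partial>lborel) = 0"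
    unfolding Lk[OF p] by (simp add: ennreal_neg)
  then have "AE x in lborel. ennreal (exp (- p * x) * k1 x) = 0"
    by (subst (asm) nn_integral_0_iff_AE) simp_all
  then have k0: "AE x in lborel. k1 x = 0"
  proof eventually_elim
    case (elim x)
    then have "exp (- p * x) * k1 x \<le> 0" by (simp only: ennreal_eq_0_iff)
    then show ?case using nn[of x] by (simp add: mult_le_0_iff)
  qed
  have le: "laplace k q \<le> 0" if "0 < q" for q
  proof -
    have "(\<integral>\<^sup>+x. ennreal (exp (- q * x) * k1 x) \<partial>lborel) = 0"
    proof (subst nn_integral_0_iff_AE)
      show "AE x in lborel. ennreal (exp (- q * x) * k1 x) = 0" using k0 by eventually_elim simp
    qed simp
    then show ?thesis unfolding Lk[OF that] by (simp only: ennreal_eq_0_iff)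
  qed
  have "eventually (\<lambda>q. 0 < laplace k q) (at_right 0)"
    using lim1 by (simp add: filterlim_at_top_dense)
  then have "eventually (\<lambda>q::real. False) (at_right 0)"
    using eventually_at_right_less[of "0::real"]
  proof eventually_elim
    case (elim q)
    with le[of q] show ?case by simp
  qed
  then show False by simp
qed

text \<open>
  Fubini's theorem needs measurability on the product, hence the Borel versions \<open>k1\<close> and \<open>\<kappa>1\<close>;
  as they vanish on the negative half-line, all convolutions become integrals over the whole line.
\<close>

locale sonine_pair =
  fixes k \<kappa> k1 \<kappa>1 :: "real \<Rightarrow> real"
  assumes k1[measurable]: "k1 \<in> borel_measurable borel" and k1_supp: "\<And>x. x \<le> 0 \<Longrightarrow> k1 x = 0"
    and k1_nn: "\<And>x. 0 \<le> k1 x" and k1_eq: "AE x in lborel. 0 < x \<longrightarrow> k x = k1 x"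
    and \<kappa>1[measurable]: "\<kappa>1 \<in> borel_measurable borel" and \<kappa>1_supp: "\<And>x. x \<le> 0 \<Longrightarrow> \<kappa>1 x = 0"
    and \<kappa>1_nn: "\<And>x. 0 \<le> \<kappa>1 x" and \<kappa>1_eq: "AE x in lborel. 0 < x \<longrightarrow> \<kappa> x = \<kappa>1 x"
    and k\<kappa>: "AE x in lborel. (\<integral>\<^sup>+s. ennreal (k1 (x - s) * \<kappa>1 s) \<partial>lborel) = ennreal (unit_step x)"
    and k1_exp_finite: "(\<integral>\<^sup>+x. ennreal (exp (- x) * k1 x) \<partial>lborel) < \<infinity>"
begin

lemma kappa_k1_conv: "AE x in lborel. (\<integral>\<^sup>+s. ennreal (\<kappa>1 (x - s) * k1 s) \<partial>lborel) = ennreal (unit_step x)"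
  using k\<kappa> unfolding nn_convolution_commute[OF k1 \<kappa>1] .

lemma Ik_conv0: "Ik a b = conv0 a b" for a b :: "real \<Rightarrow> real"
  by (simp add: fun_eq_iff Ik_def conv0_def)

section \<open>Recovering locally bounded functions: D I f = f\<close>

lemma Dk_Ik:
  assumes f: "set_borel_measurable lebesgue {0<..} f" and bnd: "\<forall>T>0. \<exists>B. \<forall>t\<in>{0<..T}. \<bar>f t\<bar> \<le> B"
  shows "AE t in lebesgue. t > 0 \<longrightarrow>
           conv0 k (Ik \<kappa> f) differentiable (at t) \<and> Dk k (Ik \<kappa> f) t = f t"
proof -
  obtain f1 where f1[measurable]: "f1 \<in> borel_measurable borel" and f1_supp: "\<And>x. x \<le> 0 \<Longrightarrow> f1 x = 0"
    and f1_eq: "AE x in lborel. 0 < x \<longrightarrow> f x = f1 x" using ex_borel_version[OF f] by blast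
  define w where "w s = (LINT r|lborel. \<kappa>1 (s - r) * f1 r)" for s
  have w[measurable]: "w \<in> borel_measurable borel" unfolding w_def by measurable
  have w_eq: "Ik \<kappa> f s = w s" for s
  proof -
    have f_eq: "AE x in lborel. 0 < x \<longrightarrow> x < s \<longrightarrow> f x = f1 x" using f1_eq by eventually_elim simp
    show ?thesis
      unfolding Ik_conv0 w_def by (rule conv0_eq_lborel[OF \<kappa>1 f1 \<kappa>1_supp f1_supp \<kappa>1_eq f_eq])
  qed
  have w_supp: "w s = 0" if "s \<le> 0" for s
  proof -
    have z: "\<kappa>1 (s - r) * f1 r = 0" for r using \<kappa>1_supp[of "s - r"] f1_supp[of r] that by (cases "r \<le> 0") auto
    show ?thesis unfolding w_def z by simp
  qed
  \<comment> \<open>Local boundedness enters here: it supplies the finiteness condition of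
    \<open>convolution_assoc\<close> with \<open>c\<close> the unit step.\<close>
  have int: "integrable lborel (\<lambda>r. unit_step (t - r) * f1 r)" if "0 < t" for t
  proof -
    from bnd[rule_format, OF that] obtain B where B: "\<forall>x\<in>{0<..t}. \<bar>f x\<bar> \<le> B" ..
    show ?thesis
    proof (rule Bochner_Integration.integrable_bound)
      show "integrable lborel (\<lambda>r. B * indicator {0..t} r)" using that by simp
      show "AE r in lborel. norm (unit_step (t - r) * f1 r) \<le> norm (B * indicator {0..t} r)"
        using f1_eq
      proof eventually_elim
        case (elim r)
        show ?case
        proof (cases "0 < r \<and> r < t")
          case True
          with B have "\<bar>f r\<bar> \<le> B" by simp
          with True elim have "\<bar>f1 r\<bar> \<le> B" by simp
          with True show ?thesis by simp
        qed (use f1_supp[of r] in \<open>auto simp: indicator_def not_less\<close>)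
      qed
    qed simp
  qed
  have K: "conv0 k (Ik \<kappa> f) t = (LINT r|lborel. unit_step (t - r) * f1 r)" if "0 < t" for t
  proof -
    have "conv0 k (Ik \<kappa> f) t = (LINT s|lborel. k1 (t - s) * w s)"
      by (rule conv0_eq_lborel[OF k1 w k1_supp w_supp k1_eq]) (simp_all add: w_eq)
    also have "\<dots> = (LINT r|lborel. unit_step (t - r) * f1 r)"
      unfolding w_def by (rule convolution_assoc(1)[OF k1 \<kappa>1 _ f1 k1_nn \<kappa>1_nn _ k\<kappa> int[OF that]]) simp_all
    finally show ?thesis .
  qed
  have "AE t in lborel. 0 < t \<longrightarrow> t < real n \<longrightarrow> (conv0 k (Ik \<kappa> f) has_real_derivative f1 t) (at t)" for n
    by (rule AE_deriv_indefinite_integral[OF f1 f1_supp int K])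
  then have "AE t in lborel. \<forall>n. 0 < t \<longrightarrow> t < real n \<longrightarrow> (conv0 k (Ik \<kappa> f) has_real_derivative f1 t) (at t)"
    by (intro AE_all_countable[THEN iffD2] allI)
  with f1_eq have "AE t in lborel. t > 0 \<longrightarrow>
         conv0 k (Ik \<kappa> f) differentiable (at t) \<and> Dk k (Ik \<kappa> f) t = f t"
  proof eventually_elim
    case (elim t)
    show ?case
    proof
      assume t: "0 < t"
      obtain n where "t < real n" using reals_Archimedean2 by blast
      with elim t have D: "(conv0 k (Ik \<kappa> f) has_real_derivative f1 t) (at t)" by blast
      \<comment> \<open>The subtracted term drops out, since \<open>Ik \<kappa> f\<close> is 0 at
        0.\<close>
      have "Dk k (Ik \<kappa> f) t = f t"
        using elim(1) t by (simp add: Dk_def DERIV_imp_deriv[OF D] w_eq w_supp)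
      with D show "conv0 k (Ik \<kappa> f) differentiable (at t) \<and> Dk k (Ik \<kappa> f) t = f t"
        by (auto simp: real_differentiable_def)
    qed
  qed
  then show ?thesis by (simp only: AE_completion_iff)
qed

section \<open>Recovering absolutely continuous functions: I D u = u - u(0)\<close>

text \<open>The primitive of \<open>k\<close> that vanishes at 0, written as a convolution with the
  unit step so that \<open>convolution_assoc\<close> applies with \<open>c = K\<close>.\<close>

definition K :: "real \<Rightarrow> real" where
  "K x = enn2real (\<integral>\<^sup>+s. ennreal (k1 (x - s) * unit_step s) \<partial>lborel)"

text \<open>Since \<open>unit_step (x - s) \<le> exp (x - s)\<close>, the integral is at most
  \<open>exp x\<close> times the Laplace integral at \<open>p = 1\<close>; in particular
  \<open>k\<close> is integrable up to 0.\<close>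

lemma K_fin: "(\<integral>\<^sup>+s. ennreal (k1 (x - s) * unit_step s) \<partial>lborel) < \<infinity>"
proof -
  have "(\<integral>\<^sup>+s. ennreal (k1 (x - s) * unit_step s) \<partial>lborel) = (\<integral>\<^sup>+s. ennreal (unit_step (x - s) * k1 s) \<partial>lborel)"
    by (rule nn_convolution_commute) simp_all
  also have "\<dots> \<le> (\<integral>\<^sup>+s. ennreal (exp x) * ennreal (exp (- 1 * s) * k1 s) \<partial>lborel)"
  proof (rule nn_integral_mono)
    fix s
    have "unit_step (x - s) * k1 s \<le> exp (x - s) * k1 s"
      by (intro mult_right_mono k1_nn) (simp add: indicator_def)
    also have "\<dots> = exp x * (exp (- 1 * s) * k1 s)" by (simp add: exp_diff exp_minus field_simps)
    finally show "ennreal (unit_step (x - s) * k1 s) \<le> ennreal (exp x) * ennreal (exp (- 1 * s) * k1 s)"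
      using k1_nn by (simp add: ennreal_mult[symmetric] ennreal_leI)
  qed
  also have "\<dots> = ennreal (exp x) * (\<integral>\<^sup>+x. ennreal (exp (- x) * k1 x) \<partial>lborel)"
    by (subst nn_integral_cmult) simp_all
  also have "\<dots> < \<infinity>" using k1_exp_finite by (simp add: ennreal_mult_less_top)
  finally show ?thesis .
qed

lemma K_nn: "0 \<le> K x" for x by (simp add: K_def)
lemma nn_conv_k1_step: "(\<integral>\<^sup>+s. ennreal (k1 (x - s) * unit_step s) \<partial>lborel) = ennreal (K x)"
  using K_fin[of x] by (simp add: K_def)
lemma nn_conv_step_k1: "(\<integral>\<^sup>+s. ennreal (unit_step (x - s) * k1 s) \<partial>lborel) = ennreal (K x)"
  unfolding nn_conv_k1_step[symmetric] by (rule nn_convolution_commute) simp_all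
lemma K_measurable[measurable]: "K \<in> borel_measurable borel" unfolding K_def by measurable
lemma K_mono: "K x \<le> K y" if "x \<le> y"
proof -
  have "ennreal (K x) \<le> ennreal (K y)"
    unfolding nn_conv_step_k1[symmetric] using that k1_nn
    by (intro nn_integral_mono ennreal_leI mult_right_mono) (auto simp: indicator_def)
  then show ?thesis using K_nn by simp
qed

lemma K_int: "K x = (LINT s|lborel. k1 (x - s) * unit_step s)" "integrable lborel (\<lambda>s. k1 (x - s) * unit_step s)"
    "integrable lborel (\<lambda>s. unit_step (x - s) * k1 s)" "K x = (LINT s|lborel. unit_step (x - s) * k1 s)"
proof -
  have "has_bochner_integral lborel (\<lambda>s. k1 (x - s) * unit_step s) (K x)"
    "has_bochner_integral lborel (\<lambda>s. unit_step (x - s) * k1 s) (K x)"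
    using k1_nn K_nn nn_conv_k1_step nn_conv_step_k1 by (auto intro!: has_bochner_integral_nn_integral)
  then show "K x = (LINT s|lborel. k1 (x - s) * unit_step s)" "integrable lborel (\<lambda>s. k1 (x - s) * unit_step s)"
    "integrable lborel (\<lambda>s. unit_step (x - s) * k1 s)" "K x = (LINT s|lborel. unit_step (x - s) * k1 s)"
    by (auto simp: has_bochner_integral_iff)
qed

text \<open>The density \<open>g\<close> represents \<open>u\<close> only on \<open>[0, T]\<close>,
  so everything is done below \<open>T\<close>.\<close>

lemma Ik_Dk_below:
  assumes u: "\<forall>T>0. abs_cont_on 0 T u" and "0 < T"
  shows "(AE t in lborel. 0 < t \<longrightarrow> t < T \<longrightarrow> conv0 k u differentiable (at t)) \<and>
      (\<forall>t. 0 < t \<longrightarrow> t < T \<longrightarrow> Ik \<kappa> (Dk k u) t = u t - u 0)"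
proof -
  obtain g where g[measurable]: "g \<in> borel_measurable borel" and g_int: "integrable lborel g"
    and g_supp: "\<And>x. x \<le> 0 \<Longrightarrow> g x = 0"
    and ug: "\<And>t. 0 \<le> t \<Longrightarrow> t \<le> T \<Longrightarrow> u t = u 0 + (LINT x:{0<..t}|lborel. g x)"
    using abs_cont_on_density[of T u] u \<open>0 < T\<close> by metis
  define G where "G \<tau> = (LINT r|lborel. unit_step (\<tau> - r) * g r)" for \<tau>
  have [measurable]: "G \<in> borel_measurable borel" unfolding G_def by measurable
  have G_supp: "G t = 0" if "t \<le> 0" for t
  proof -
    have z: "unit_step (t - r) * g r = 0" for r using g_supp[of r] that by (auto simp: indicator_def)
    show ?thesis unfolding G_def z by simp
  qed
  have uG: "u t = u 0 + G t" if "0 \<le> t" "t \<le> T" for t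
  proof -
    have "AE r in lborel. indicator {0<..t} r * g r = unit_step (t - r) * g r"
      using AE_lborel_singleton[of t] by eventually_elim (use g_supp in \<open>auto simp: indicator_def\<close>)
    then have "(LINT x:{0<..t}|lborel. g x) = G t"
      unfolding set_lebesgue_integral_def G_def by (intro integral_cong_AE) simp_all
    then show ?thesis using ug[OF that] by simp
  qed
  have cg_int: "integrable lborel (\<lambda>r. unit_step (t - r) * g r)" for t
    by (rule Bochner_Integration.integrable_bound[OF g_int]) (auto simp: indicator_def)
  have Kg_int: "integrable lborel (\<lambda>r. K (t - r) * g r)" for t
  proof (rule Bochner_Integration.integrable_bound)
    show "integrable lborel (\<lambda>r. K t * g r)" using g_int by simp
    show "AE r in lborel. norm (K (t - r) * g r) \<le> norm (K t * g r)"
    proof (rule AE_I2)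
      fix r show "norm (K (t - r) * g r) \<le> norm (K t * g r)"
        using K_mono[of "t - r" t] K_nn g_supp[of r]
        by (cases "r \<le> 0") (auto simp: abs_mult intro!: mult_right_mono)
    qed
  qed simp
  define w where "w s = (LINT r|lborel. k1 (s - r) * g r)" for s
  have w[measurable]: "w \<in> borel_measurable borel" unfolding w_def by measurable
  have w_supp: "w s = 0" if "s \<le> 0" for s
  proof -
    have z: "k1 (s - r) * g r = 0" for r using k1_supp[of "s - r"] g_supp[of r] that by (cases "r \<le> 0") auto
    show ?thesis unfolding w_def z by simp
  qed
  \<comment> \<open>Associativity is used twice with \<open>c = K\<close>: the integral of
    \<open>K (t - r) * g r\<close> is the common value of \<open>k * (1 * g)\<close> and
    \<open>1 * (k * g)\<close>, which moves the primitive from \<open>g\<close> to the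
    outside.\<close>
  have kG: "(LINT s|lborel. k1 (t - s) * G s) = (LINT r|lborel. K (t - r) * g r)"
      "integrable lborel (\<lambda>s. k1 (t - s) * G s)" for t
    unfolding G_def
    using convolution_assoc[OF k1 _ K_measurable g k1_nn _ K_nn _ Kg_int[of t], where b="unit_step"] by (auto simp: nn_conv_k1_step)
  have cw: "(LINT s|lborel. unit_step (t - s) * w s) = (LINT r|lborel. K (t - r) * g r)"
      "integrable lborel (\<lambda>s. unit_step (t - s) * w s)" for t
    unfolding w_def
    using convolution_assoc[OF _ k1 K_measurable g _ k1_nn K_nn _ Kg_int[of t], where a="unit_step"] by (auto simp: nn_conv_step_k1)
  define h where "h s = u 0 * k1 s + w s" for s
  have h[measurable]: "h \<in> borel_measurable borel" unfolding h_def by measurable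
  have ch: "unit_step (t - s) * h s = u 0 * (unit_step (t - s) * k1 s) + unit_step (t - s) * w s" for t s
    by (simp add: h_def algebra_simps)
  have ku: "conv0 k u t = (LINT r|lborel. unit_step (t - r) * h r)" if "0 < t" "t < T" for t
  proof -
    have "conv0 k u t = (LINT s|lborel. k1 (t - s) * (unit_step s * (u 0 + G s)))"
    proof (rule conv0_eq_lborel[OF k1 _ k1_supp _ k1_eq])
      show "AE x in lborel. 0 < x \<longrightarrow> x < t \<longrightarrow> u x = unit_step x * (u 0 + G x)"
      proof (rule AE_I2, intro impI)
        fix x assume "0 < x" "x < t"
        then show "u x = unit_step x * (u 0 + G x)" using uG[of x] that by simp
      qed
    qed auto
    also have "\<dots> = (LINT s|lborel. u 0 * (k1 (t - s) * unit_step s) + k1 (t - s) * G s)"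
      by (rule Bochner_Integration.integral_cong)
         (use G_supp in \<open>auto simp: indicator_def algebra_simps not_less\<close>)
    also have "\<dots> = u 0 * K t + (LINT r|lborel. K (t - r) * g r)"
      using K_int(1,2)[of t] kG[of t] by (simp add: Bochner_Integration.integral_add)
    also have "\<dots> = (LINT r|lborel. unit_step (t - r) * h r)"
      unfolding ch using K_int(3,4)[of t] cw[of t] by (simp add: Bochner_Integration.integral_add)
    finally show ?thesis .
  qed
  have "AE t in lborel. 0 < t \<longrightarrow> t < T \<longrightarrow> (conv0 k u has_real_derivative h t) (at t)"
  proof (rule AE_deriv_indefinite_integral[OF h])
    show "h x = 0" if "x \<le> 0" for x using that by (simp add: h_def k1_supp w_supp)
    show "integrable lborel (\<lambda>r. unit_step (t - r) * h r)" for t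
      unfolding ch using K_int(3)[of t] cw(2)[of t] by simp
  qed (rule ku)
  note deriv = this
  have "AE t in lborel. 0 < t \<longrightarrow> t < T \<longrightarrow> conv0 k u differentiable (at t)"
    using deriv by eventually_elim (auto simp: real_differentiable_def)
  moreover have "Ik \<kappa> (Dk k u) t = u t - u 0" if t: "0 < t" "t < T" for t
  proof -
    \<comment> \<open>The derivative is \<open>h = u 0 * k1 + w\<close>, and the term
      \<open>k s * u 0\<close> subtracted in \<open>Dk\<close> removes its first summand.\<close>
    have Dk_eq: "AE s in lborel. 0 < s \<longrightarrow> s < t \<longrightarrow> Dk k u s = w s"
      using deriv k1_eq
      by eventually_elim (use t in \<open>auto simp: Dk_def h_def dest!: DERIV_imp_deriv\<close>)
    have "Ik \<kappa> (Dk k u) t = (LINT s|lborel. \<kappa>1 (t - s) * w s)"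
      unfolding Ik_conv0 by (rule conv0_eq_lborel[OF \<kappa>1 w \<kappa>1_supp w_supp \<kappa>1_eq Dk_eq])
    also have "\<dots> = G t"
      unfolding w_def G_def
      by (rule convolution_assoc(1)[OF \<kappa>1 k1 _ g \<kappa>1_nn k1_nn _ kappa_k1_conv cg_int]) simp_all
    also have "\<dots> = u t - u 0" using uG[of t] t by simp
    finally show ?thesis .
  qed
  ultimately show ?thesis by blast
qed

lemma Ik_Dk:
  assumes u: "\<forall>T>0. abs_cont_on 0 T u"
  shows "(AE t in lebesgue. t > 0 \<longrightarrow> conv0 k u differentiable (at t)) \<and> (\<forall>t>0. Ik \<kappa> (Dk k u) t = u t - u 0)"
proof -
  have "AE t in lborel. 0 < t \<longrightarrow> t < real (Suc n) \<longrightarrow> conv0 k u differentiable (at t)" for n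
    using Ik_Dk_below[OF u, of "real (Suc n)"] by simp
  then have "AE t in lborel. \<forall>n. 0 < t \<longrightarrow> t < real (Suc n) \<longrightarrow> conv0 k u differentiable (at t)"
    by (intro AE_all_countable[THEN iffD2] allI)
  then have "AE t in lborel. 0 < t \<longrightarrow> conv0 k u differentiable (at t)"
  proof eventually_elim
    case (elim t)
    obtain n where "t < real n" using reals_Archimedean2 by blast
    then have "t < real (Suc n)" by simp
    with elim show ?case by blast
  qed
  moreover have "Ik \<kappa> (Dk k u) t = u t - u 0" if "0 < t" for t
    using Ik_Dk_below[OF u, of "t + 1"] that by auto
  ultimately show ?thesis by (simp only: AE_completion_iff) blast
qed

end

theorem theorem1:
  fixes k \<kappa> :: "real \<Rightarrow> real"
  assumes k_nonneg: "\<And>t. t > 0 \<Longrightarrow> k t \<ge> 0"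
    and k_locint: "\<And>a b. 0 < a \<Longrightarrow> set_integrable lebesgue {a..b} k"
    and k_laplace: "\<And>p. p > 0 \<Longrightarrow> set_integrable lebesgue {0<..} (\<lambda>t. exp (- p * t) * k t)"
    and k_stieltjes: "stieltjes_function (laplace k)"
    and lim1: "filterlim (laplace k) at_top (at_right 0)"
    and lim2: "(laplace k \<longlongrightarrow> 0) at_top"
    and lim3: "((\<lambda>p. p * laplace k p) \<longlongrightarrow> 0) (at_right 0)"
    and lim4: "filterlim (\<lambda>p. p * laplace k p) at_top at_top"
    and kappa_cm: "completely_monotone \<kappa>"
    and kappa_laplace: "\<And>p. p > 0 \<Longrightarrow>
           set_integrable lebesgue {0<..} (\<lambda>s. exp (- p * s) * \<kappa> s) \<and>
           laplace \<kappa> p = 1 / (p * laplace k p)"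
  shows
    "(\<forall>f :: real \<Rightarrow> real.
        set_borel_measurable lebesgue {0<..} f \<and>
        (\<forall>T>0. \<exists>B. \<forall>t\<in>{0<..T}. \<bar>f t\<bar> \<le> B) \<longrightarrow>
        (AE t in lebesgue. t > 0 \<longrightarrow>
           conv0 k (Ik \<kappa> f) differentiable (at t) \<and> Dk k (Ik \<kappa> f) t = f t))
     \<and>
     (\<forall>u :: real \<Rightarrow> real.
        (\<forall>T>0. abs_cont_on 0 T u) \<longrightarrow>
        (AE t in lebesgue. t > 0 \<longrightarrow> conv0 k u differentiable (at t)) \<and>
        (\<forall>t>0. Ik \<kappa> (Dk k u) t = u t - u 0))"
proof -
  have kappa_nonneg: "0 \<le> \<kappa> t" if "0 < t" for t
    using kappa_cm[unfolded completely_monotone_def, THEN spec[of _ 0], THEN spec[of _ t]] that by simp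
  obtain k1 where k1[measurable]: "k1 \<in> borel_measurable borel" and k1_supp: "\<And>x. x \<le> 0 \<Longrightarrow> k1 x = 0"
    and k1_nn: "\<And>x. 0 \<le> k1 x" and k1_eq: "AE x in lborel. 0 < x \<longrightarrow> k x = k1 x"
    using ex_nonneg_borel_version[OF k_laplace[OF zero_less_one] k_nonneg] by blast
  obtain \<kappa>1 where \<kappa>1[measurable]: "\<kappa>1 \<in> borel_measurable borel" and \<kappa>1_supp: "\<And>x. x \<le> 0 \<Longrightarrow> \<kappa>1 x = 0"
    and \<kappa>1_nn: "\<And>x. 0 \<le> \<kappa>1 x" and \<kappa>1_eq: "AE x in lborel. 0 < x \<longrightarrow> \<kappa> x = \<kappa>1 x"
    using ex_nonneg_borel_version[OF conjunct1[OF kappa_laplace[OF zero_less_one]] kappa_nonneg] by blast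
  have Lk: "(\<integral>\<^sup>+x. ennreal (exp (- p * x) * k1 x) \<partial>lborel) = ennreal (laplace k p)" if "0 < p" for p
    by (rule nn_integral_exp_eq_laplace[OF k_laplace[OF that] k1 k1_supp k1_nn k1_eq])
  have L\<kappa>: "(\<integral>\<^sup>+x. ennreal (exp (- p * x) * \<kappa>1 x) \<partial>lborel) = ennreal (laplace \<kappa> p)" if "0 < p" for p
    by (rule nn_integral_exp_eq_laplace[OF conjunct1[OF kappa_laplace[OF that]] \<kappa>1 \<kappa>1_supp \<kappa>1_nn \<kappa>1_eq])
  have Lk_pos: "0 < laplace k p" if "0 < p" for p
    by (rule laplace_pos[OF lim1 k1 k1_nn Lk that])
  have k\<kappa>: "AE x in lborel. (\<integral>\<^sup>+s. ennreal (k1 (x - s) * \<kappa>1 s) \<partial>lborel) = ennreal (unit_step x)"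
  proof (rule convolution_eq_indicator[OF k1 \<kappa>1 k1_nn \<kappa>1_nn k1_supp \<kappa>1_supp])
    fix p :: real assume p: "0 < p"
    have "laplace k p * (1 / (p * laplace k p)) = 1 / p" using Lk_pos[OF p] by simp
    then show "(\<integral>\<^sup>+x. ennreal (exp (- p * x) * k1 x) \<partial>lborel) * (\<integral>\<^sup>+x. ennreal (exp (- p * x) * \<kappa>1 x) \<partial>lborel)
        = ennreal (1 / p)"
      using p Lk_pos[OF p] unfolding Lk[OF p] L\<kappa>[OF p] conjunct2[OF kappa_laplace[OF p]]
      by (subst ennreal_mult[symmetric]) simp_all
  qed
  have fin: "(\<integral>\<^sup>+x. ennreal (exp (- x) * k1 x) \<partial>lborel) < \<infinity>"
    using Lk[of 1] by simp
  interpret sonine_pair k \<kappa> k1 \<kappa>1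
    by (rule sonine_pair.intro[OF k1 k1_supp k1_nn k1_eq \<kappa>1 \<kappa>1_supp \<kappa>1_nn \<kappa>1_eq k\<kappa> fin])
  show ?thesis using Dk_Ik Ik_Dk by blast
qed

end
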